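(* Let $\mathbf A^{(1)},\dots,\mathbf A^{(s)}\in\mathbb R^{d\times d}$ be positive semi-definite matrices stored on $s$ nodes, let $\mathbf A=\sum_{i=1}^s\mathbf A^{(i)}$ have eigenvalues $\sigma_1\ge\cdots\ge\sigma_d\ge0$, and let $k\le q\le p\le d$ with $\sigma_k>\sigma_{q+1}$. Fix an error tolerance $\epsilon\in(0,1)$ and run the distributed power method without noise ($\nu=0$) for $L=\Theta\left(\frac{\sigma_k}{\sigma_k-\sigma_{q+1}}\log(d/\epsilon)\right)$ iterations. Then with high probability $$\|(\mathbf I-\mathbf X_L\mathbf X_L^\top)\mathbf U_k\|_2\le\epsilon,$$ where $\mathbf U_k$ consists of the top-$k$ eigenvectors of $\mathbf A$.
   Context: Distributed power method (without noise): let $\mathbf X_0\in\mathbb R^{d\times p}$ be the orthonormal QR factor of a random $d\times p$ matrix with i.i.d. standard normal entries. For $\ell=1,\dots,L$: the central node broadcasts $\mathbf X_{\ell-1}$ to all $s$ nodes; node $i$ returns $\mathbf Y_\ell^{(i)}=\mathbf A^{(i)}\mathbf X_{\ell-1}$; the central node computes $\mathbf Y_\ell=\sum_{i=1}^s\mathbf Y_\ell^{(i)}$ and the QR factorization $\mathbf Y_\ell=\mathbf X_\ell\mathbf R_\ell$ with $\mathbf X_\ell\in\mathbb R^{d\times p}$ having orthonormal columns. The output is $\mathbf X_L$. "With high probability" means with probability at least $1-\tau^{-\Omega(p+1-q)}-e^{-\Omega(d)}$ for a constant $\tau>1$, where the constant in the choice of $L=\Theta(\cdot)$ is suitably large and may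 depend on $\tau$, and $\Omega(\cdot)$ hides positive absolute constants. $\sigma_{d+1}:=0$. *)

theory Defs
  imports
    "HOL-Probability.Probability"
    "Jordan_Normal_Form.Char_Poly"
begin

text \<open>
  All dimensions vary inside the statement (the constants hidden in the asymptotic notation must not
  depend on them), so matrices are the carrier-based ones of \<^typ>\<open>real mat\<close>.
\<close>

definition psd_mat :: "nat \<Rightarrow> real mat \<Rightarrow> bool" where
  "psd_mat d A \<longleftrightarrow> A \<in> carrier_mat d d \<and> transpose_mat A = A \<and>
     (\<forall>v\<in>carrier_vec d. 0 \<le> scalar_prod v (A *\<^sub>v v))"

text \<open>\<^typ>\<open>real mat\<close> has no zero, hence no sum over index sets, without fixing the dimensions.\<close>

definition mat_sum :: "nat \<Rightarrow> nat \<Rightarrow> nat \<Rightarrow> (nat \<Rightarrow> real mat) \<Rightarrow> real mat" where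
  "mat_sum m n s B = mat m n (\<lambda>(a, b). \<Sum>i<s. B i $$ (a, b))"

definition orthonormal_cols :: "real mat \<Rightarrow> bool" where
  "orthonormal_cols X \<longleftrightarrow> transpose_mat X * X = 1\<^sub>m (dim_col X)"

definition vec_norm2 :: "real vec \<Rightarrow> real" where
  "vec_norm2 v = sqrt (scalar_prod v v)"

definition spectral_norm :: "real mat \<Rightarrow> real" where
  "spectral_norm B =
     Sup {vec_norm2 (B *\<^sub>v v) | v. v \<in> carrier_vec (dim_col B) \<and> vec_norm2 v \<le> 1}"

text \<open>
  The eigenvalues are indexed from 1, listed with multiplicity, and followed by the convention
  \<open>\<sigma> (d + 1) = 0\<close>.
\<close>

definition ordered_eigenvalues :: "nat \<Rightarrow> real mat \<Rightarrow> (nat \<Rightarrow> real) \<Rightarrow> bool" where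
  "ordered_eigenvalues d A \<sigma> \<longleftrightarrow>
     char_poly A = (\<Prod>i=1..d. [:- \<sigma> i, 1:]) \<and>
     antimono_on {1..d} \<sigma> \<and> (\<forall>i\<in>{1..d}. 0 \<le> \<sigma> i) \<and> \<sigma> (d + 1) = 0"

text \<open>
  The columns of \<open>U\<close> (counted from 0) are orthonormal eigenvectors for \<open>\<sigma> 1, \<dots>, \<sigma> k\<close>. If
  \<open>\<sigma> k = \<sigma> (k + 1)\<close>, even the span of \<open>U\<close> is not unique; any choice is admitted.
\<close>

definition top_eigenvectors :: "nat \<Rightarrow> nat \<Rightarrow> real mat \<Rightarrow> (nat \<Rightarrow> real) \<Rightarrow> real mat \<Rightarrow> bool" where
  "top_eigenvectors d k A \<sigma> U \<longleftrightarrow>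
     U \<in> carrier_mat d k \<and> orthonormal_cols U \<and>
     (\<forall>j<k. eigenvector A (col U j) (\<sigma> (j + 1)))"

text \<open>
  \<open>X\<close> is an orthonormal QR factor of \<open>Y\<close>. This is a relation, since the factor is not unique: signs
  are free, and so is part of the column space when \<open>Y\<close> is rank deficient.
\<close>

definition qr_factor :: "nat \<Rightarrow> nat \<Rightarrow> real mat \<Rightarrow> real mat \<Rightarrow> bool" where
  "qr_factor d p Y X \<longleftrightarrow>
     X \<in> carrier_mat d p \<and> orthonormal_cols X \<and>
     (\<exists>R\<in>carrier_mat p p. upper_triangular R \<and> Y = X * R)"

definition distributed_power_run ::
  "nat \<Rightarrow> nat \<Rightarrow> nat \<Rightarrow> (nat \<Rightarrow> real mat) \<Rightarrow> real mat \<Rightarrow> nat \<Rightarrow> (nat \<Rightarrow> real mat) \<Rightarrow> bool" where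
  "distributed_power_run d p s A G L X \<longleftrightarrow>
     qr_factor d p G (X 0) \<and>
     (\<forall>l\<in>{1..L}. qr_factor d p (mat_sum d p s (\<lambda>i. A i * X (l - 1))) (X l))"

text \<open>
  The law of a \<open>d \<times> p\<close> matrix with i.i.d. standard normal entries; an outcome \<open>g\<close> is the family of
  entries, and the matrix itself is \<open>mat d p g\<close>.
\<close>

definition gaussian_entries :: "nat \<Rightarrow> nat \<Rightarrow> (nat \<times> nat \<Rightarrow> real) measure" where
  "gaussian_entries d p =
     Pi\<^sub>M ({..<d} \<times> {..<p}) (\<lambda>_. density lborel (\<lambda>x. ennreal (std_normal_density x)))"

end

(*
  Let G be the Gaussian matrix and S the span of the top q eigenvectors of A. If w is the
  component of a vector u in the span of U orthogonal to the range of X_L, then A^L w is annihilated by G^T. Splitting A^L w = y_S + y_T along the top q and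
  the remaining eigenvectors of A, y_T has norm at most sigma_{q+1}^L |w|, the equation
  G^T y_S = - G^T y_T bounds y_S by a polynomial in d times that, and
  |w|^2 = <w, u> = <y_S, A^{-L} u> gives |w| <= poly(d) (sigma_{q+1} / sigma_k)^L.

  The bound on y_S needs G^T to be bounded below on S, with a loss polynomial in d only. If G^T y is small
  while y_l = 1, then row l of G is close to an affine space of dimension at most q - 1 determined by the
  other rows. Such a space has p + 1 - q normals in triangular position with respect to pivot
  coordinates in which they have entry 1 and maximal modulus; integrating over one pivot after the other
  bounds the conditional probability by a (p + 1 - q)-th power. Rotation invariance is not needed.
*)
theory Submission
  imports Defs
begin

text \<open>Polynomial losses in d are affordable because L carries a factor log (d / \<epsilon>),
  whereas a constant lost per normal would be raised to the power p + 1 - q and compete with the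
  base \<tau>, which is arbitrary. Hence the threshold 1 / (\<tau> d^2) for G^T on S: one factor d
  outweighs the sums of at most p terms, the other one the union over the d choices of the row l.

  Rows are treated one at a time because the coefficients of y_S depend on G through X_L, so the
  lower bound must hold for all coefficient vectors at once. Scaling to y_l = 1 turns this
  uniformity into distance from one affine space that is independent of row l, and no net on the
  sphere is required. At the end y_S is bounded coordinate by coordinate, at the price of sqrt d.

  A may be singular and Y_l rank deficient; then X_l spans directions that are not determined by G.
  Ranges are therefore never compared: orthogonality to X_L is pulled back to G through the
  equations Y_l = X_l R_l. Likewise A^{-L} u is only a figure of speech for an inequality on those
  eigenvalues at which u has a nonzero coordinate.\<close>

unbundle no vec_syntax and no inner_syntax

section \<open>Spectral theorem for real symmetric matrices\<close>

text \<open>Reflection in the hyperplane orthogonal to \<open>v\<close> minus the first unit vector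
  swaps these two vectors. Being symmetric and its own inverse, it is an orthogonal change of basis
  starting with \<open>v\<close>, so that deflation becomes the conjugation
  \<open>H * A * H\<close>.\<close>

lemma householder:
  fixes v :: "real vec"
  assumes v: "v \<in> carrier_vec n" and vv: "v \<bullet> v = 1" and n: "0 < n"
  obtains H where "H \<in> carrier_mat n n" "transpose_mat H = H" "H * H = 1\<^sub>m n" "col H 0 = v"
proof -
  define u where "u i = v $ i - (if i = 0 then 1 else 0)" for i
  \<comment> \<open>If \<open>v\<close> is the first unit vector, then \<open>c = 2 / 0 = 0\<close> and \<open>H\<close> is the identity, as it should be.\<close>
  define c where "c = 2 / (\<Sum>i<n. u i * u i)"
  define H where "H = mat n n (\<lambda>(i,j). (if i = j then 1 else 0) - c * u i * u j)"
  have uu: "(\<Sum>i<n. u i * u i) = 2 - 2 * v $ 0"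
  proof -
    have "(\<Sum>i<n. u i * u i) = (\<Sum>i<n. v $ i * v $ i + (if i = 0 then 1 - 2 * v $ 0 else 0))"
      by (intro sum.cong) (auto simp: u_def algebra_simps)
    also have "\<dots> = v \<bullet> v + (1 - 2 * v $ 0)"
      using n v by (simp add: sum.distrib scalar_prod_def lessThan_atLeast0)
    finally show ?thesis using vv by simp
  qed
  have c2: "c * c * (\<Sum>i<n. u i * u i) = 2 * c"
    by (simp add: c_def power2_eq_square divide_simps)
  have "H * H = 1\<^sub>m n"
  proof (rule eq_matI)
    fix i j assume "i < dim_row (1\<^sub>m n :: real mat)" "j < dim_col (1\<^sub>m n :: real mat)"
    then have ij: "i < n" "j < n" by auto
    have "(H * H) $$ (i, j) = (\<Sum>l<n. ((if i = l then 1 else 0) - c * u i * u l) * ((if l = j then 1 else 0) - c * u l * u j))"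
      using ij by (simp add: H_def scalar_prod_def lessThan_atLeast0)
    also have "\<dots> = (\<Sum>l<n. (if i = l then (if i = j then 1 else 0) - c * u i * u j else 0) 
         - (if l = j then c * u i * u j else 0) + c * c * (u l * u l) * (u i * u j))"
      by (intro sum.cong) (auto simp: algebra_simps)
    also have "\<dots> = (if i = j then 1 else 0) - 2 * c * u i * u j + c * c * (\<Sum>l<n. u l * u l) * (u i * u j)"
      using ij by (simp add: sum.distrib sum_subtractf sum_distrib_left sum_distrib_right)
    also have "\<dots> = (if i = j then 1 else 0)"
      unfolding c2 by simp
    finally show "(H * H) $$ (i, j) = 1\<^sub>m n $$ (i, j)" using ij by simp
  qed (auto simp: H_def)
  moreover have "col H 0 = v"
  proof (rule eq_vecI)
    fix i assume "i < dim_vec v"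
    then have i: "i < n" using v by simp
    have "c * u i * u 0 = - u i"
    proof (cases "v $ 0 = 1")
      case True
      have "\<forall>j<n. u j * u j = 0"
        using uu True sum_nonneg_eq_0_iff[of "{..<n}" "\<lambda>j. u j * u j"] by simp
      then have "u i = 0" using i by simp
      then show ?thesis by simp
    next
      case False
      have "c * u 0 = -1" unfolding c_def uu using False by (simp add: u_def field_simps)
      then show ?thesis by (metis mult.assoc mult.commute mult_minus1)
    qed
    then show "col H 0 $ i = v $ i"
      using i n by (auto simp: H_def u_def)
  qed (use v in \<open>simp add: H_def\<close>)
  moreover have "transpose_mat H = H"
    by (rule eq_matI) (auto simp: H_def)
  moreover have "H \<in> carrier_mat n n" by (simp add: H_def)
  ultimately show ?thesis using that by blast
qed

lemma mult_block_diag_mat: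
  assumes "A \<in> carrier_mat 1 1" "A' \<in> carrier_mat 1 1" "B \<in> carrier_mat m m" "B' \<in> carrier_mat m m"
  shows "four_block_mat A (0\<^sub>m 1 m) (0\<^sub>m m 1) B * four_block_mat A' (0\<^sub>m 1 m) (0\<^sub>m m 1) B' =
    (four_block_mat (A * A') (0\<^sub>m 1 m) (0\<^sub>m m 1) (B * B') :: real mat)"
proof -
  note z = zero_carrier_mat[of 1 m] zero_carrier_mat[of m 1]
  show ?thesis
    unfolding mult_four_block_mat[OF assms(1) z assms(3) assms(2) z assms(4)]
    by (rule cong_four_block_mat) (use assms in \<open>auto simp: left_mult_zero_mat[of _ _ m]\<close>)
qed

text \<open>Deflation along \<open>es\<close>: after conjugation by a reflection that starts with a
  unit eigenvector for \<open>e\<close>, the first column is diagonal, by symmetry so is the first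
  row, and the remaining block is symmetric with the remaining roots. The diagonal inherits the
  order of the given list, which is what later singles out the top q eigenvectors.\<close>

lemma symmetric_mat_diagonalization:
  fixes A :: "real mat"
  assumes "A \<in> carrier_mat n n" "transpose_mat A = A" "char_poly A = (\<Prod>e\<leftarrow>es. [:- e, 1:])"
  shows "\<exists>W\<in>carrier_mat n n. transpose_mat W * W = 1\<^sub>m n \<and>
    transpose_mat W * A * W = mat n n (\<lambda>(i,j). if i = j then es ! i else 0)"
  using assms
proof (induction es arbitrary: n A)
  case Nil
  have "n = 0" using degree_monic_char_poly[OF Nil(1)] Nil(3) by auto
  then show ?case using Nil(1) by (auto intro!: bexI[of _ "1\<^sub>m 0"])
next
  case (Cons e es)
  note A = Cons.prems(1) and sym = Cons.prems(2)
  have "degree (\<Prod>e\<leftarrow>e # es. [:- e, 1:]) = Suc (length es)"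
    by (subst degree_prod_list_eq) (auto simp: sum_list_triv o_def)
  then have n: "n = Suc (length es)" using degree_monic_char_poly[OF A] Cons.prems(3) by metis
  define m where "m = length es"
  have nm: "n = Suc m" using n m_def by simp
  have "eigenvalue A e" unfolding eigenvalue_root_char_poly[OF A] Cons.prems(3) by simp
  then obtain v0 where v0: "v0 \<in> carrier_vec n" "v0 \<noteq> 0\<^sub>v n" "A *\<^sub>v v0 = e \<cdot>\<^sub>v v0"
    unfolding eigenvalue_def eigenvector_def using A by auto
  define v where "v = (1 / sqrt (v0 \<bullet> v0)) \<cdot>\<^sub>v v0"
  have pos: "v0 \<bullet> v0 > 0" using conjugate_square_greater_0_vec[OF v0(1)] v0(2) by simp
  have v: "v \<in> carrier_vec n" using v0 by (simp add: v_def)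
  have vv: "v \<bullet> v = 1" using v0 pos by (simp add: v_def)
  have Av: "A *\<^sub>v v = e \<cdot>\<^sub>v v" using v0 A by (simp add: v_def mult_mat_vec smult_smult_assoc mult.commute)
  obtain H where H: "H \<in> carrier_mat n n" "transpose_mat H = H" "H * H = 1\<^sub>m n" "col H 0 = v"
    using householder[OF v vv] nm by auto
  define A' where "A' = H * A * H"
  have A': "A' \<in> carrier_mat n n" using H A by (simp add: A'_def)
  have symA': "transpose_mat A' = A'"
    using H A sym by (simp add: A'_def transpose_mult[of _ n n _ n] assoc_mult_mat[of _ n n _ n _ n])
  have A'0: "A' $$ (i, 0) = (if i = 0 then e else 0)" if i: "i < n" for i
  proof -
    have "A' $$ (i, 0) = (H * (A * H)) $$ (i, 0)" 
      using H A by (simp add: A'_def assoc_mult_mat[of _ n n _ n _ n])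
    also have "\<dots> = row H i \<bullet> (A *\<^sub>v v)"
      using i H A nm by (metis col_mult2 index_mult_mat(1) carrier_matD index_mult_mat(3) zero_less_Suc)
    also have "\<dots> = e * (row H i \<bullet> col H 0)" unfolding Av using H v i by (metis carrier_matD(2) row_carrier scalar_prod_smult_distrib)
    also have "row H i \<bullet> col H 0 = (H * H) $$ (i, 0)" using i H(1) nm by (subst index_mult_mat(1)) auto
    also have "\<dots> = (if i = 0 then 1 else 0)" unfolding H(3) using i nm by simp
    finally show ?thesis by simp
  qed
  have A'0': "A' $$ (0, i) = (if i = 0 then e else 0)" if i: "i < n" for i
  proof -
    have "A' $$ (0, i) = transpose_mat A' $$ (0, i)" using symA' by simp
    also have "\<dots> = A' $$ (i, 0)" using A' i nm by simp
    finally show ?thesis using A'0[OF i] by simp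
  qed
  define A3 where "A3 = mat m m (\<lambda>(i,j). A' $$ (Suc i, Suc j))"
  define E1 where "E1 = mat 1 1 (\<lambda>_. e)"
  have A3: "A3 \<in> carrier_mat m m" by (simp add: A3_def)
  have E1: "E1 \<in> carrier_mat 1 1" by (simp add: E1_def)
  have block: "A' = four_block_mat E1 (0\<^sub>m 1 m) (0\<^sub>m m 1) A3"
    by (rule eq_matI) (use A' nm A'0 A'0' in \<open>auto simp: A3_def E1_def\<close>)
  have symA3: "transpose_mat A3 = A3"
  proof (rule eq_matI)
    fix i j assume ij: "i < dim_row A3" "j < dim_col A3"
    have "A' $$ (Suc j, Suc i) = transpose_mat A' $$ (Suc i, Suc j)"
      using ij A' nm by (simp add: A3_def)
    then show "transpose_mat A3 $$ (i, j) = A3 $$ (i, j)"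
      using ij symA' by (simp add: A3_def)
  qed (auto simp: A3_def)
  have "similar_mat A' A"
    unfolding similar_mat_def similar_mat_wit_def A'_def
    using H A by (intro exI[of _ H]) (auto simp: Let_def)
  from char_poly_similar[OF this]
  have "char_poly A' = [:- e, 1:] * (\<Prod>e\<leftarrow>es. [:- e, 1:])"
    unfolding Cons.prems(3) by simp
  moreover have "char_poly A' = char_poly E1 * char_poly A3"
    unfolding block by (rule char_poly_four_block_zeros_col) (use E1 A3 in auto)
  moreover have "char_poly E1 = [:- e, 1:]"
    by (simp add: E1_def char_poly_defs det_def sign_def)
  ultimately have "char_poly A3 = (\<Prod>e\<leftarrow>es. [:- e, 1:])"
    by (metis mult_cancel_left pCons_eq_0_iff zero_neq_one)
  from Cons.IH[OF A3 symA3 this] obtain V where V: "V \<in> carrier_mat m m" "transpose_mat V * V = 1\<^sub>m m"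
    "transpose_mat V * A3 * V = mat m m (\<lambda>(i,j). if i = j then es ! i else 0)" by auto
  define F where "F = four_block_mat (1\<^sub>m 1) (0\<^sub>m 1 m) (0\<^sub>m m 1) V"
  have "F \<in> carrier_mat (1 + m) (1 + m)"
    unfolding F_def by (rule four_block_carrier_mat) (use V in auto)
  then have F: "F \<in> carrier_mat n n" using nm by simp
  have FT: "transpose_mat F = four_block_mat (1\<^sub>m 1) (0\<^sub>m 1 m) (0\<^sub>m m 1) (transpose_mat V)"
    unfolding F_def by (subst transpose_four_block_mat[where ?nr1.0=1 and ?nc1.0=1 and ?nr2.0=m and ?nc2.0=m]) (use V in auto)
  have VT: "transpose_mat V \<in> carrier_mat m m" using V by simp
  have FTF: "transpose_mat F * F = 1\<^sub>m n"
    unfolding FT unfolding F_def by (subst mult_block_diag_mat[OF _ _ VT V(1)]) (use V nm in auto)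
  have FA: "transpose_mat F * A' = four_block_mat E1 (0\<^sub>m 1 m) (0\<^sub>m m 1) (transpose_mat V * A3)"
    unfolding FT block by (subst mult_block_diag_mat[OF _ E1 VT A3]) (use E1 in auto)
  have FAF: "transpose_mat F * A' * F = four_block_mat E1 (0\<^sub>m 1 m) (0\<^sub>m m 1) (transpose_mat V * A3 * V)"
    unfolding FA unfolding F_def
    by (subst mult_block_diag_mat[OF E1 one_carrier_mat mult_carrier_mat[OF VT A3] V(1)]) (use E1 in auto)
  have D: "transpose_mat F * A' * F = mat n n (\<lambda>(i,j). if i = j then (e # es) ! i else 0)"
    unfolding FAF V(3) by (rule eq_matI) (auto simp: E1_def nm nth_Cons' split: if_splits)
  define W where "W = H * F"
  have W: "W \<in> carrier_mat n n" using H F by (simp add: W_def)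
  have WT: "transpose_mat W = transpose_mat F * H" using H F by (simp add: W_def transpose_mult[of _ n n _ n])
  have FT': "transpose_mat F \<in> carrier_mat n n" using F by simp
  have "transpose_mat W * W = transpose_mat F * ((H * H) * F)"
    unfolding WT unfolding W_def using H(1) F FT' by (simp add: assoc_mult_mat[of _ n n _ n _ n] mult_carrier_mat)
  then have 1: "transpose_mat W * W = 1\<^sub>m n" using H FTF F by simp
  have "transpose_mat W * A * W = transpose_mat F * A' * F"
    unfolding WT unfolding W_def A'_def using H(1) F FT' A 
    by (simp add: assoc_mult_mat[of _ n n _ n _ n] mult_carrier_mat)
  with 1 D W show ?case by auto
qed

section \<open>Small ball probabilities\<close>

text \<open>A singular square system has a kernel vector; dividing it by an entry of maximal modulus
  gives the normalization. The entry 1 serves as pivot for an integration, and the bound 1 on the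
  others keeps the error of a linear form within p times the entrywise error.\<close>

lemma underdetermined_system_solution:
  fixes F :: "(nat \<Rightarrow> real) set"
  assumes F: "finite F" "card F < p"
  obtains v i where "i < p" "v i = 1" "\<And>j. j < p \<Longrightarrow> \<bar>v j\<bar> \<le> 1" "\<And>f. f \<in> F \<Longrightarrow> (\<Sum>j<p. v j * f j) = 0"
proof -
  obtain fs where fs: "set fs = F" "length fs = card F"
    using F(1) by (metis finite_distinct_list distinct_card)
  define c where "c i = (if i < length fs then vec p (fs ! i) else 0\<^sub>v p)" for i
  \<comment> \<open>The equations occupy the rows below \<open>card F\<close>; row
    \<open>card F\<close>, which exists because \<open>card F < p\<close>, is zero, and this makes
    the determinant vanish.\<close>
  define B where "B = mat\<^sub>r p p (\<lambda>i. if i = card F then 0\<^sub>v p else c i)"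
  have B: "B \<in> carrier_mat p p" by (simp add: B_def)
  have "det B = 0"
    unfolding B_def by (rule det_row_0[OF F(2)]) (auto simp: c_def)
  then obtain x where x: "x \<in> carrier_vec p" "x \<noteq> 0\<^sub>v p" "B *\<^sub>v x = 0\<^sub>v p"
    using det_0_iff_vec_prod_zero[OF B] by auto
  have sol: "(\<Sum>j<p. x $ j * f j) = 0" if f: "f \<in> F" for f
  proof -
    obtain i where i: "i < length fs" "f = fs ! i" using f unfolding fs(1)[symmetric] in_set_conv_nth by blast
    have "0 = (B *\<^sub>v x) $ i" using x(3) i fs F by simp
    also have "\<dots> = (\<Sum>j<p. f j * x $ j)"
      using i fs F x(1) by (simp add: B_def c_def scalar_prod_def lessThan_atLeast0)
    finally show ?thesis by (simp add: mult.commute)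
  qed
  define M where "M = Max ((\<lambda>j. \<bar>x $ j\<bar>) ` {..<p})"
  have p: "{..<p} \<noteq> {}" using F by auto
  have "M \<in> (\<lambda>j. \<bar>x $ j\<bar>) ` {..<p}" unfolding M_def using p by (intro Max_in) auto
  then obtain i where i: "i < p" "M = \<bar>x $ i\<bar>" by auto
  have le: "\<bar>x $ j\<bar> \<le> M" if "j < p" for j unfolding M_def using that by (intro Max_ge) auto
  have "\<exists>j<p. x $ j \<noteq> 0"
  proof (rule ccontr)
    assume "\<not> ?thesis"
    then have "x = 0\<^sub>v p" using x(1) by (intro eq_vecI) auto
    then show False using x(2) by simp
  qed
  then have M: "M > 0" using le by (metis order_less_le_trans zero_less_abs_iff)
  have nz: "x $ i \<noteq> 0" using i M by auto
  show ?thesis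
  proof (rule that[of i "\<lambda>j. x $ j / x $ i"])
    show "\<bar>x $ j / x $ i\<bar> \<le> 1" if "j < p" for j
      using le[OF that] M i(2) by (simp add: abs_divide)
    show "(\<Sum>j<p. x $ j / x $ i * f j) = 0" if "f \<in> F" for f
    proof -
      have "(\<Sum>j<p. x $ j / x $ i * f j) = (\<Sum>j<p. x $ j * f j) / x $ i"
        by (simp add: sum_divide_distrib)
      then show ?thesis using sol[OF that] by simp
    qed
  qed (use i nz in auto)
qed

text \<open>The combinations of the \<open>h b\<close> whose coefficients satisfy one linear
  equation form an affine space with at most q - 1 independent directions. A normal with index a has
  to be orthogonal to these and to vanish at a earlier pivots; since q - 1 + a < p exactly for a < p
  + 1 - q, this many normals can be found one after the other.\<close>

lemma affine_hull_normals:
  fixes h :: "nat \<Rightarrow> nat \<Rightarrow> real" and \<beta> :: "nat \<Rightarrow> real"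
  assumes b0: "b0 < q" "\<beta> b0 \<noteq> 0" and m: "m \<le> p + 1 - q" "q \<le> p"
  shows "\<exists>N piv c. \<forall>a<m. piv a < p \<and> N a (piv a) = 1 \<and> (\<forall>j<p. \<bar>N a j\<bar> \<le> 1) \<and> (\<forall>b<a. N a (piv b) = 0) \<and>
    (\<forall>x. (\<Sum>b<q. x b * \<beta> b) = 1 \<longrightarrow> (\<Sum>j<p. N a j * (\<Sum>b<q. x b * h b j)) = (c a :: real))"
  using m(1)
proof (induction m)
  case 0
  then show ?case by simp
next
  case (Suc m)
  then obtain N piv c where IH: "\<forall>a<m. piv a < p \<and> N a (piv a) = 1 \<and> (\<forall>j<p. \<bar>N a j\<bar> \<le> 1) \<and> (\<forall>b<a. N a (piv b) = 0) \<and>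
    (\<forall>x. (\<Sum>b<q. x b * \<beta> b) = 1 \<longrightarrow> (\<Sum>j<p. N a j * (\<Sum>b<q. x b * h b j)) = (c a :: real))"
    by auto
  \<comment> \<open>Directions of the affine space, obtained by eliminating the coefficient of
    \<open>b0\<close>, together with the unit vectors at the earlier pivots.\<close>
  define F where "F = (\<lambda>b j. h b j - \<beta> b / \<beta> b0 * h b0 j) ` ({..<q} - {b0}) \<union> (\<lambda>a j. if j = piv a then 1 else 0) ` {..<m}"
  have fin: "finite F" by (simp add: F_def)
  have "card F \<le> card ({..<q} - {b0}) + card {..<m}"
    unfolding F_def by (rule order_trans[OF card_Un_le]) (intro add_mono card_image_le; simp)
  also have "\<dots> < p" using b0 Suc.prems m(2) by simp
  finally have less: "card F < p" .
  obtain v i where v: "i < p" "v i = 1" "\<And>j. j < p \<Longrightarrow> \<bar>v j\<bar> \<le> 1" "\<And>f. f \<in> F \<Longrightarrow> (\<Sum>j<p. v j * f j) = 0"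
    by (rule underdetermined_system_solution[OF fin less]) (rule that)
  define H where "H b = (\<Sum>j<p. v j * h b j)" for b
  have vpiv: "v (piv a) = 0" if "a < m" for a
  proof -
    have "0 = (\<Sum>j<p. v j * (if j = piv a then 1 else 0))" using v(4) that by (simp add: F_def)
    also have "\<dots> = (\<Sum>j<p. if j = piv a then v j else 0)" by (intro sum.cong) auto
    finally show ?thesis using IH that by simp
  qed
  \<comment> \<open>Orthogonality to the directions makes the pairing with \<open>h b\<close>
    proportional to \<open>\<beta> b\<close>, hence constant where the coefficients pair with
    \<beta> to 1.\<close>
  have H: "H b = \<beta> b / \<beta> b0 * H b0" if "b < q" for b
  proof (cases "b = b0")
    case False
    then have "(\<Sum>j<p. v j * (h b j - \<beta> b / \<beta> b0 * h b0 j)) = 0"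
      using that by (intro v(4)) (auto simp: F_def)
    then show ?thesis
      by (simp add: H_def right_diff_distrib sum_subtractf sum_distrib_left mult.left_commute)
  qed (use b0 in simp)
  have new: "(\<Sum>j<p. v j * (\<Sum>b<q. x b * h b j)) = H b0 / \<beta> b0" if "(\<Sum>b<q. x b * \<beta> b) = 1" for x
  proof -
    have "(\<Sum>j<p. v j * (\<Sum>b<q. x b * h b j)) = (\<Sum>b<q. x b * H b)"
      unfolding H_def sum_distrib_left by (subst sum.swap) (simp add: mult.left_commute)
    also have "\<dots> = (\<Sum>b<q. x b * (\<beta> b / \<beta> b0 * H b0))" using H by (intro sum.cong) auto
    also have "\<dots> = (\<Sum>b<q. x b * \<beta> b) * (H b0 / \<beta> b0)"
      by (simp add: sum_distrib_right sum_divide_distrib mult.assoc)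
    finally show ?thesis using that by simp
  qed
  show ?case
  proof (rule exI[of _ "N(m := v)"], rule exI[of _ "piv(m := i)"], rule exI[of _ "c(m := H b0 / \<beta> b0)"], intro allI impI)
    fix a assume "a < Suc m"
    then consider "a < m" | "a = m" by linarith
    then show "(piv(m := i)) a < p \<and> (N(m := v)) a ((piv(m := i)) a) = 1 \<and> (\<forall>j<p. \<bar>(N(m := v)) a j\<bar> \<le> 1) \<and>
      (\<forall>b<a. (N(m := v)) a ((piv(m := i)) b) = 0) \<and>
      (\<forall>x. (\<Sum>b<q. x b * \<beta> b) = 1 \<longrightarrow>
        (\<Sum>j<p. (N(m := v)) a j * (\<Sum>b<q. x b * h b j)) = (c(m := H b0 / \<beta> b0)) a)"
    proof cases
      case 1
      then show ?thesis using IH by simp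
    next
      case 2
      then show ?thesis using v(1-3) vpiv new by simp
    qed
  qed
qed

section \<open>Gaussian measure of intervals, tails and triangular systems of slabs\<close>

abbreviation std_gaussian :: "real measure" where
  "std_gaussian \<equiv> density lborel (\<lambda>x. ennreal (std_normal_density x))"

text \<open>The density is at most 1 / sqrt (2 pi), hence at most 1 / 2, and the interval has length
  2 \<delta>. That the constant in front of \<delta> is 1 matters, since the bound is raised to the
  power p + 1 - q.\<close>

lemma std_gaussian_interval:
  assumes "0 \<le> \<delta>"
  shows "emeasure std_gaussian {a - \<delta>..a + \<delta>} \<le> ennreal \<delta>"
proof -
  have le: "std_normal_density x \<le> 1 / 2" for x
  proof -
    have "2 \<le> sqrt (2 * pi)" using pi_gt3 by (intro real_le_rsqrt) simp
    then have "1 / sqrt (2 * pi) \<le> 1 / 2" by (intro divide_left_mono) auto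
    moreover have "exp (- x\<^sup>2 / 2) \<le> 1" by simp
    ultimately have "1 / sqrt (2 * pi) * exp (- x\<^sup>2 / 2) \<le> 1 / 2 * 1" by (intro mult_mono) auto
    then show ?thesis by (simp add: std_normal_density_def)
  qed
  have "emeasure std_gaussian {a - \<delta>..a + \<delta>} =
      (\<integral>\<^sup>+x. ennreal (std_normal_density x) * indicator {a - \<delta>..a + \<delta>} x \<partial>lborel)"
    by (simp add: emeasure_density)
  also have "\<dots> \<le> (\<integral>\<^sup>+x. ennreal (1 / 2) * indicator {a - \<delta>..a + \<delta>} x \<partial>lborel)"
    by (intro nn_integral_mono mult_right_mono ennreal_leI le) auto
  also have "\<dots> = ennreal (1 / 2) * ennreal (2 * \<delta>)"
    using assms by (subst nn_integral_cmult_indicator) auto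
  also have "\<dots> = ennreal \<delta>" using assms by (subst ennreal_mult[symmetric]) auto
  finally show ?thesis .
qed

text \<open>Exponential tilting: the standard density equals exp (1 / 2 - s x) times the normal
  density centred at s, for s = 1 or s = -1. With s the sign of x the first factor is at most exp (1
  / 2 - K) on the tail. Exponential decay suffices, because K will be a multiple of d.\<close>

lemma std_gaussian_tail:
  "emeasure std_gaussian {x. K < \<bar>x\<bar>} \<le> ennreal (2 * exp (1 / 2 - K))"
proof -
  have shift: "std_normal_density x = exp (1 / 2 - s * x) * normal_density s 1 x" if "s * s = 1" for s x :: real
  proof -
    have "exp (- x\<^sup>2 / 2) = exp (1 / 2 - s * x) * exp (- (x - s)\<^sup>2 / 2)"
      unfolding exp_add[symmetric] using that by (simp add: power2_eq_square field_simps)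
    then show ?thesis by (simp add: normal_density_def)
  qed
  have le: "std_normal_density x * indicator {x. K < \<bar>x\<bar>} x
      \<le> exp (1 / 2 - K) * (normal_density 1 1 x + normal_density (-1) 1 x)" for x
  proof (cases "K < \<bar>x\<bar>")
    case True
    define s :: real where "s = (if x \<ge> 0 then 1 else -1)"
    have "s * x \<ge> K" "s * s = 1" using True by (auto simp: s_def)
    then have "std_normal_density x \<le> exp (1 / 2 - K) * normal_density s 1 x"
      unfolding shift[OF \<open>s * s = 1\<close>] by (intro mult_right_mono) auto
    also have "\<dots> \<le> exp (1 / 2 - K) * (normal_density 1 1 x + normal_density (-1) 1 x)"
      by (intro mult_left_mono) (auto simp: s_def)
    finally show ?thesis using True by simp
  qed simp
  have one: "(\<integral>\<^sup>+x. ennreal (normal_density s 1 x) \<partial>lborel) = 1" for s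
    by (subst nn_integral_eq_integral) auto
  have "emeasure std_gaussian {x. K < \<bar>x\<bar>} =
      (\<integral>\<^sup>+x. ennreal (std_normal_density x * indicator {x. K < \<bar>x\<bar>} x) \<partial>lborel)"
    by (subst emeasure_density) (auto intro!: nn_integral_cong simp: indicator_def)
  also have "\<dots> \<le> (\<integral>\<^sup>+x. ennreal (exp (1 / 2 - K)) * (ennreal (normal_density 1 1 x) + ennreal (normal_density (-1) 1 x)) \<partial>lborel)"
    by (intro nn_integral_mono) (subst ennreal_plus[symmetric], simp, simp, subst ennreal_mult[symmetric], simp, simp, rule ennreal_leI[OF le])
  also have "\<dots> = ennreal (exp (1 / 2 - K)) * 2"
    by (subst nn_integral_cmult, measurable) (simp add: nn_integral_add one)
  also have "\<dots> = ennreal (2 * exp (1 / 2 - K))"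
    by (simp add: ennreal_mult mult.commute)
  finally show ?thesis .
qed

text \<open>Only form 0 can involve the coordinate \<open>piv 0\<close>, and it does so with
  coefficient 1. With the other coordinates fixed, constraint 0 thus confines that coordinate to an
  interval of radius \<delta>, at a cost of \<delta>; the remaining constraints form a triangular
  system in the other coordinates.\<close>

lemma PiM_triangular_small_ball:
  fixes N :: "real measure" and n :: "nat \<Rightarrow> 'i \<Rightarrow> real"
  assumes N: "prob_space N" and setsN: "sets N = sets borel"
    and ball: "\<And>a. emeasure N {a - \<delta>..a + \<delta>} \<le> ennreal \<delta>" and \<delta>: "0 \<le> \<delta>"
    and "finite I" "\<And>a. a < m \<Longrightarrow> piv a \<in> I" "\<And>a. a < m \<Longrightarrow> n a (piv a) = 1"
    and "\<And>a b. a < m \<Longrightarrow> b < a \<Longrightarrow> n a (piv b) = 0"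
  shows "{x \<in> space (Pi\<^sub>M I (\<lambda>_. N)). \<forall>a<m. \<bar>(\<Sum>i\<in>I. n a i * x i) - c a\<bar> \<le> \<delta>} \<in> sets (Pi\<^sub>M I (\<lambda>_. N))"
    (is "?S I m n c \<in> _")
    "emeasure (Pi\<^sub>M I (\<lambda>_. N)) {x \<in> space (Pi\<^sub>M I (\<lambda>_. N)). \<forall>a<m. \<bar>(\<Sum>i\<in>I. n a i * x i) - c a\<bar> \<le> \<delta>}
      \<le> ennreal (\<delta> ^ m)"
proof -
  interpret N: prob_space N by fact
  interpret product_prob_space "\<lambda>_::'i. N" by standard
  note setsN[measurable_cong]
  have S[measurable]: "?S I m n c \<in> sets (Pi\<^sub>M I (\<lambda>_. N))" if "finite I" for I m n c
    by measurable
  show "?S I m n c \<in> sets (Pi\<^sub>M I (\<lambda>_. N))" by (rule S) fact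
  show "emeasure (Pi\<^sub>M I (\<lambda>_. N)) (?S I m n c) \<le> ennreal (\<delta> ^ m)"
    using assms(5-)
  proof (induction m arbitrary: I n c piv)
    case 0
    have "prob_space (Pi\<^sub>M I (\<lambda>_. N))" by (intro prob_space_PiM N)
    then show ?case using prob_space.emeasure_space_1[of "Pi\<^sub>M I (\<lambda>_. N)"] by simp
  next
    case (Suc m)
    define i where "i = piv 0"
    define I' where "I' = I - {i}"
    have I: "finite I'" "i \<notin> I'" "insert i I' = I"
      using Suc.prems(1,2) by (auto simp: I'_def i_def)
    define n' c' where "n' a = n (Suc a)" and "c' a = c (Suc a)" for a
    have n0: "n 0 i = 1" using Suc.prems(3) by (simp add: i_def)
    have nS: "n (Suc a) i = 0" if "a < m" for a using Suc.prems(4) that by (simp add: i_def)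
    \<comment> \<open>The pivots are distinct: a later form is 1 at its own pivot and 0 at
      \<open>piv 0\<close>.\<close>
    have piv: "piv (Suc a) \<in> I'" if "a < m" for a
    proof -
      have "piv (Suc a) \<noteq> i" using nS[OF that] Suc.prems(3)[of "Suc a"] that by auto
      then show ?thesis using Suc.prems(2) that by (simp add: I'_def)
    qed
    have IH: "emeasure (Pi\<^sub>M I' (\<lambda>_. N)) (?S I' m n' c') \<le> ennreal (\<delta> ^ m)"
    proof (rule Suc.IH[OF I(1) piv])
      show "n' a (piv (Suc a)) = 1" if "a < m" for a
        unfolding n'_def by (rule Suc.prems(3)) (use that in simp)
      show "n' a (piv (Suc b)) = 0" if "a < m" "b < a" for a b
        unfolding n'_def by (rule Suc.prems(4)) (use that in simp_all)
    qed
    \<comment> \<open>Centre of the interval left to coordinate \<open>i\<close> by constraint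
      0.\<close>
    define r where "r x = c 0 - (\<Sum>k\<in>I'. n 0 k * x k)" for x
    have sum: "(\<Sum>k\<in>I. n a k * (x(i := y)) k) = n a i * y + (\<Sum>k\<in>I'. n a k * x k)" for a x y
    proof -
      have "(\<Sum>k\<in>I'. n a k * (x(i := y)) k) = (\<Sum>k\<in>I'. n a k * x k)"
        using I by (intro sum.cong) auto
      then show ?thesis unfolding I(3)[symmetric] using I(1,2) by simp
    qed
    have le: "indicator (?S I (Suc m) n c) (x(i := y))
        \<le> (indicator (?S I' m n' c') x * indicator {r x - \<delta>..r x + \<delta>} y :: ennreal)"
      if x: "x \<in> space (Pi\<^sub>M I' (\<lambda>_. N))" for x y
    proof (cases "x(i := y) \<in> ?S I (Suc m) n c")
      case True
      then have *: "\<forall>a<Suc m. \<bar>n a i * y + (\<Sum>k\<in>I'. n a k * x k) - c a\<bar> \<le> \<delta>"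
        unfolding sum[symmetric] by blast
      have "\<bar>(\<Sum>k\<in>I'. n' a k * x k) - c' a\<bar> \<le> \<delta>" if "a < m" for a
        using *[rule_format, of "Suc a"] nS that by (simp add: n'_def c'_def)
      then have "x \<in> ?S I' m n' c'" using x by simp
      moreover have "y \<in> {r x - \<delta>..r x + \<delta>}" using *[rule_format, of 0] n0 by (auto simp: r_def)
      ultimately show ?thesis by (simp add: indicator_def)
    qed simp
    have "emeasure (Pi\<^sub>M I (\<lambda>_. N)) (?S I (Suc m) n c)
        = (\<integral>\<^sup>+x. indicator (?S I (Suc m) n c) x \<partial>Pi\<^sub>M (insert i I') (\<lambda>_. N))"
      unfolding I(3) by (simp only: nn_integral_indicator S[OF Suc.prems(1)])
    also have "\<dots> = (\<integral>\<^sup>+x. (\<integral>\<^sup>+y. indicator (?S I (Suc m) n c) (x(i := y)) \<partial>N) \<partial>Pi\<^sub>M I' (\<lambda>_. N))"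
      using S[OF Suc.prems(1), of "Suc m" n c]
      by (intro product_nn_integral_insert I borel_measurable_indicator) (simp only: I(3))
    also have "\<dots> \<le> (\<integral>\<^sup>+x. (\<integral>\<^sup>+y. indicator (?S I' m n' c') x * indicator {r x - \<delta>..r x + \<delta>} y \<partial>N) \<partial>Pi\<^sub>M I' (\<lambda>_. N))"
      by (intro nn_integral_mono le)
    also have "\<dots> \<le> (\<integral>\<^sup>+x. indicator (?S I' m n' c') x * ennreal \<delta> \<partial>Pi\<^sub>M I' (\<lambda>_. N))"
    proof (intro nn_integral_mono)
      fix x
      have "(\<integral>\<^sup>+y. indicator (?S I' m n' c') x * indicator {r x - \<delta>..r x + \<delta>} y \<partial>N)
          = indicator (?S I' m n' c') x * emeasure N {r x - \<delta>..r x + \<delta>}"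
        by (rule nn_integral_cmult_indicator) (simp add: setsN)
      also have "\<dots> \<le> indicator (?S I' m n' c') x * ennreal \<delta>"
        by (intro mult_left_mono ball) auto
      finally show "(\<integral>\<^sup>+y. indicator (?S I' m n' c') x * indicator {r x - \<delta>..r x + \<delta>} y \<partial>N)
          \<le> indicator (?S I' m n' c') x * ennreal \<delta>" .
    qed
    also have "\<dots> = emeasure (Pi\<^sub>M I' (\<lambda>_. N)) (?S I' m n' c') * ennreal \<delta>"
      using S[OF I(1), of m n' c']
      by (simp only: nn_integral_multc borel_measurable_indicator nn_integral_indicator)
    also have "\<dots> \<le> ennreal (\<delta> ^ m) * ennreal \<delta>"
      by (intro mult_right_mono IH) auto
    also have "\<dots> = ennreal (\<delta> ^ Suc m)"
      using \<delta> by (simp add: ennreal_mult mult.commute)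
    finally show ?case .
  qed
qed

section \<open>Lower bound for the Gaussian matrix on a fixed subspace\<close>

lemma prob_space_std_gaussian: "prob_space std_gaussian"
  by (rule prob_space_normal_density) simp

text \<open>
  Restricting \<open>x\<close> to rational coefficients makes the event a countable union, hence measurable;
  the inequality being strict, nothing is lost.
\<close>

lemma gaussian_row_small_ball:
  fixes w :: "nat \<Rightarrow> nat \<Rightarrow> real"
  assumes l: "l < d" and q: "1 \<le> q" "q \<le> p" and t: "0 \<le> t"
  defines "B \<equiv> {g \<in> space (gaussian_entries d p). \<exists>x\<in>PiE {..<q} (\<lambda>_. \<rat>).
    \<forall>j<p. \<bar>\<Sum>a<d. (\<Sum>b<q. x b * w b a) * g (a, j)\<bar> < t * \<bar>\<Sum>b<q. x b * w b l\<bar>}"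
  shows "B \<in> sets (gaussian_entries d p)"
    and "emeasure (gaussian_entries d p) B \<le> ennreal ((real p * t) ^ (p + 1 - q))"
proof -
  interpret N: prob_space std_gaussian by (rule prob_space_std_gaussian)
  interpret product_prob_space "\<lambda>_::nat \<times> nat. std_gaussian" by standard
  define M where "M = (\<lambda>I :: (nat \<times> nat) set. Pi\<^sub>M I (\<lambda>_. std_gaussian))"
  have gM: "gaussian_entries d p = M ({..<d} \<times> {..<p})" by (simp add: gaussian_entries_def M_def)
  have count: "countable (PiE {..<q} (\<lambda>_. \<rat> :: real set))"
    by (intro countable_PiE) (auto simp: countable_rat)
  show B[measurable]: "B \<in> sets (gaussian_entries d p)"
  proof -
    define b where "b x = {g \<in> space (M ({..<d} \<times> {..<p})). \<forall>j<p. \<bar>\<Sum>a<d. (\<Sum>b<q. x b * w b a) * g (a, j)\<bar> < t * \<bar>\<Sum>b<q. x b * w b l\<bar>}" for x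
    have "b x \<in> sets (M ({..<d} \<times> {..<p}))" for x
      unfolding b_def M_def by measurable
    then have "(\<Union>x\<in>PiE {..<q} (\<lambda>_. \<rat>). b x) \<in> sets (M ({..<d} \<times> {..<p}))"
      by (intro sets.countable_UN'' count)
    also have "(\<Union>x\<in>PiE {..<q} (\<lambda>_. \<rat>). b x) = B"
      unfolding B_def b_def gM by blast
    finally show ?thesis unfolding gM .
  qed
  define m where "m = p + 1 - q"
  show "emeasure (gaussian_entries d p) B \<le> ennreal ((real p * t) ^ (p + 1 - q))"
  proof (cases "\<forall>b<q. w b l = 0")
    case True
    then have zero: "(\<Sum>b<q. x b * w b l) = 0" for x by (intro sum.neutral) auto
    have "0 < p" using q by simp
    then have "\<not> (\<forall>j<p. \<bar>\<Sum>a<d. (\<Sum>b<q. x b * w b a) * g (a, j)\<bar> < t * \<bar>\<Sum>b<q. x b * w b l\<bar>)" for x g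
      unfolding zero by auto
    then have "B = {}" unfolding B_def by blast
    then show ?thesis by simp
  next
    case False
    then obtain b0 where b0: "b0 < q" "w b0 l \<noteq> 0" by auto
    \<comment> \<open>Row l of the Gaussian matrix is split off from the other rows. These are then
      frozen at \<open>z\<close>, so that the normals below are constants for the integration over
      row l.\<close>
    define J R where "J = {l} \<times> {..<p}" and "R = ({..<d} - {l}) \<times> {..<p}"
    have JR: "R \<inter> J = {}" "finite R" "finite J" "R \<union> J = {..<d} \<times> {..<p}"
      using l by (auto simp: J_def R_def)
    have "emeasure (gaussian_entries d p) B = (\<integral>\<^sup>+g. indicator B g \<partial>gaussian_entries d p)"
      using B by simp
    also have "\<dots> = (\<integral>\<^sup>+z. (\<integral>\<^sup>+y. indicator B (merge R J (z, y)) \<partial>M J) \<partial>M R)"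
      unfolding gM M_def JR(4)[symmetric]
      by (rule product_nn_integral_fold) (use JR B gM in \<open>auto simp: M_def\<close>)
    also have "\<dots> \<le> (\<integral>\<^sup>+z. ennreal ((real p * t) ^ m) \<partial>M R)"
    proof (rule nn_integral_mono)
      fix z :: "nat \<times> nat \<Rightarrow> real"
      define h where "h b j = (\<Sum>a\<in>{..<d} - {l}. w b a * z (a, j))" for b j
      obtain N piv c where npc: "\<forall>a<m. piv a < p \<and> N a (piv a) = 1 \<and> (\<forall>j<p. \<bar>N a j\<bar> \<le> 1) \<and> (\<forall>b<a. N a (piv b) = 0) \<and>
          (\<forall>x. (\<Sum>b<q. x b * w b l) = 1 \<longrightarrow> (\<Sum>j<p. N a j * (\<Sum>b<q. x b * h b j)) = (c a :: real))"
        using affine_hull_normals[of b0 q "\<lambda>b. w b l" m p h] b0 q m_def by auto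
      \<comment> \<open>Row l nearly cancels a point of the affine space, hence the minus sign
        before \<open>c a\<close>.\<close>
      define S where "S = {y \<in> space (Pi\<^sub>M J (\<lambda>_. std_gaussian)). \<forall>a<m. \<bar>(\<Sum>i\<in>J. N a (snd i) * y i) - (- c a)\<bar> \<le> real p * t}"
      have "0 \<le> real p * t" using t by simp
      note sb = PiM_triangular_small_ball[OF prob_space_std_gaussian _ std_gaussian_interval[OF this] this JR(3),
          where piv = "\<lambda>a. (l, piv a)" and n = "\<lambda>a i. N a (snd i)" and m = m and c = "\<lambda>a. - c a", folded S_def]
      have S: "S \<in> sets (M J)" "emeasure (M J) S \<le> ennreal ((real p * t) ^ m)"
        unfolding M_def by (rule sb; use npc in \<open>auto simp: J_def\<close>)+
      have sub: "y \<in> S" if y: "y \<in> space (M J)" and mem: "merge R J (z, y) \<in> B" for y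
      proof -
        define g where "g = merge R J (z, y)"
        have gl: "g (l, j) = y (l, j)" if "j < p" for j
          using that by (simp add: g_def merge_def J_def R_def)
        have ga: "g (a, j) = z (a, j)" if "j < p" "a \<in> {..<d} - {l}" for a j
          using that by (auto simp: g_def merge_def J_def R_def)
        obtain x where x: "\<And>j. j < p \<Longrightarrow> \<bar>\<Sum>a<d. (\<Sum>b<q. x b * w b a) * g (a, j)\<bar> < t * \<bar>\<Sum>b<q. x b * w b l\<bar>"
          using mem unfolding B_def g_def by blast
        define Y where "Y = (\<Sum>b<q. x b * w b l)"
        have "0 < t * \<bar>Y\<bar>" using x[of 0] q by (simp add: Y_def)
        then have Y: "Y \<noteq> 0" by auto
        \<comment> \<open>The condition is homogeneous in \<open>x\<close>. Scaling the coordinate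
          at l to 1 turns the relative error \<open>t * \<bar>Y\<bar>\<close> into the absolute
          error \<open>t\<close>.\<close>
        define x' where "x' b = x b / Y" for b
        have x'1: "(\<Sum>b<q. x' b * w b l) = 1"
          using Y by (simp add: x'_def Y_def sum_divide_distrib[symmetric])
        have close: "\<bar>y (l, j) + (\<Sum>b<q. x' b * h b j)\<bar> \<le> t" if j: "j < p" for j
        proof -
          have "(\<Sum>a<d. (\<Sum>b<q. x b * w b a) * g (a, j))
            = Y * y (l, j) + (\<Sum>a\<in>{..<d} - {l}. (\<Sum>b<q. x b * w b a) * z (a, j))"
            using l j by (subst sum.remove[of _ l]) (auto simp: gl ga Y_def)
          also have "(\<Sum>a\<in>{..<d} - {l}. (\<Sum>b<q. x b * w b a) * z (a, j)) = (\<Sum>b<q. x b * h b j)"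
            unfolding h_def sum_distrib_left sum_distrib_right by (subst sum.swap) (simp add: mult.assoc)
          also have "\<dots> = Y * (\<Sum>b<q. x' b * h b j)"
            using Y by (simp add: x'_def sum_distrib_left)
          finally have "\<bar>Y\<bar> * \<bar>y (l, j) + (\<Sum>b<q. x' b * h b j)\<bar> < \<bar>Y\<bar> * t"
            using x[OF j] by (simp add: Y_def[symmetric] abs_mult[symmetric] distrib_left mult.commute)
          then show ?thesis using Y by simp
        qed
        have "\<bar>(\<Sum>i\<in>J. N a (snd i) * y i) - (- c a)\<bar> \<le> real p * t" if a: "a < m" for a
        proof -
          have "(\<Sum>i\<in>J. N a (snd i) * y i) = (\<Sum>j<p. N a j * y (l, j))"
            unfolding J_def by (rule sum.reindex_bij_witness[of _ "\<lambda>j. (l, j)" snd]) auto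
          moreover have "(\<Sum>j<p. N a j * (\<Sum>b<q. x' b * h b j)) = c a"
            using npc a x'1 by blast
          ultimately have "(\<Sum>i\<in>J. N a (snd i) * y i) - (- c a) = (\<Sum>j<p. N a j * (y (l, j) + (\<Sum>b<q. x' b * h b j)))"
            by (simp add: distrib_left sum.distrib)
          also have "\<bar>\<dots>\<bar> \<le> (\<Sum>j<p. \<bar>N a j * (y (l, j) + (\<Sum>b<q. x' b * h b j))\<bar>)"
            by (rule sum_abs)
          \<comment> \<open>The p entries of a normal have modulus at most 1; this is the origin of
            the factor p.\<close>
          also have "\<dots> \<le> (\<Sum>j<p. 1 * t)"
            unfolding abs_mult using npc a close by (intro sum_mono mult_mono) auto
          finally show ?thesis by simp
        qed
        then show ?thesis using y by (simp add: S_def M_def)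
      qed
      have "(\<integral>\<^sup>+y. indicator B (merge R J (z, y)) \<partial>M J) \<le> (\<integral>\<^sup>+y. indicator S y \<partial>M J)"
        by (intro nn_integral_mono) (auto simp: indicator_def dest: sub)
      also have "\<dots> = emeasure (M J) S" using S(1) by simp
      finally show "(\<integral>\<^sup>+y. indicator B (merge R J (z, y)) \<partial>M J) \<le> ennreal ((real p * t) ^ m)"
        using S(2) by (rule order_trans)
    qed
    also have "\<dots> = ennreal ((real p * t) ^ m)"
      using prob_space.emeasure_space_1[OF prob_space_PiM, of R "\<lambda>_. std_gaussian"]
      by (simp add: M_def prob_space_std_gaussian)
    finally show ?thesis by (simp add: m_def)
  qed
qed

text \<open>Finitely many strict inequalities between continuous functions of the coefficients
  survive a small enough move to a rational point.\<close>

lemma rational_approximation: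
  fixes x :: "nat \<Rightarrow> real" and f :: "nat \<Rightarrow> nat \<Rightarrow> real"
  assumes "\<And>j. j < p \<Longrightarrow> \<bar>\<Sum>b<q. x b * f j b\<bar> < t * \<bar>\<Sum>b<q. x b * \<beta> b\<bar>"
  obtains r where "r \<in> PiE {..<q} (\<lambda>_. \<rat>)" "\<And>j. j < p \<Longrightarrow> \<bar>\<Sum>b<q. r b * f j b\<bar> < t * \<bar>\<Sum>b<q. r b * \<beta> b\<bar>"
proof -
  have "\<exists>u. (\<forall>n. u n \<in> \<rat>) \<and> u \<longlonglongrightarrow> y" for y :: real
    using closure_sequential[of y "\<rat>"] Rats_closure_real by auto
  then obtain u where u: "\<And>y n. u y n \<in> \<rat>" "\<And>y. u y \<longlonglongrightarrow> (y :: real)" by metis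
  \<comment> \<open>Membership in \<open>PiE\<close> fixes the values outside the index set as well,
    hence the restriction.\<close>
  define s where "s n = restrict (\<lambda>b. u (x b) n) {..<q}" for n
  have lim: "(\<lambda>n. \<Sum>b<q. s n b * g b) \<longlonglongrightarrow> (\<Sum>b<q. x b * g b)" for g
    by (intro tendsto_intros) (simp add: s_def u)
  have "\<forall>\<^sub>F n in sequentially. \<forall>j\<in>{..<p}. 0 < t * \<bar>\<Sum>b<q. s n b * \<beta> b\<bar> - \<bar>\<Sum>b<q. s n b * f j b\<bar>"
  proof (intro eventually_ball_finite ballI)
    fix j assume "j \<in> {..<p}"
    then have "0 < t * \<bar>\<Sum>b<q. x b * \<beta> b\<bar> - \<bar>\<Sum>b<q. x b * f j b\<bar>" using assms by simp
    then show "\<forall>\<^sub>F n in sequentially. 0 < t * \<bar>\<Sum>b<q. s n b * \<beta> b\<bar> - \<bar>\<Sum>b<q. s n b * f j b\<bar>"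
      by (rule order_tendstoD(1)[rotated]) (intro tendsto_intros lim)
  qed simp
  then obtain n where "\<forall>j\<in>{..<p}. 0 < t * \<bar>\<Sum>b<q. s n b * \<beta> b\<bar> - \<bar>\<Sum>b<q. s n b * f j b\<bar>"
    using eventually_happens'[OF sequentially_bot] by blast
  then show ?thesis using that[of "s n"] u(1) by (auto simp: s_def)
qed

text \<open>All randomness is settled here. The vectors \<open>w\<close> are fixed before the matrix
  is drawn, whereas \<open>x\<close> is quantified inside the event: it will be instantiated with
  coefficients that depend on \<open>g\<close> through the output of the iteration.\<close>

lemma gaussian_entries_good_event:
  fixes w :: "nat \<Rightarrow> nat \<Rightarrow> real"
  assumes \<tau>: "1 < \<tau>" and q: "1 \<le> q" "q \<le> p" "p \<le> d"
  obtains E where "E \<in> sets (gaussian_entries d p)"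
    "measure (gaussian_entries d p) E \<ge> 1 - \<tau> powr (- real (p + 1 - q)) - exp (- real d)"
    "\<And>g i j. g \<in> E \<Longrightarrow> i < d \<Longrightarrow> j < p \<Longrightarrow> \<bar>g (i, j)\<bar> \<le> 8 * real d"
    "\<And>g l x. g \<in> E \<Longrightarrow> l < d \<Longrightarrow> \<exists>j<p. \<bar>\<Sum>b<q. x b * w b l\<bar> / (\<tau> * (real d)\<^sup>2)
      \<le> \<bar>\<Sum>a<d. (\<Sum>b<q. x b * w b a) * g (a, j)\<bar>"
proof -
  define G where "G = gaussian_entries d p"
  interpret prob_space G unfolding G_def gaussian_entries_def
    by (intro prob_space_PiM prob_space_std_gaussian)
  interpret N: prob_space std_gaussian by (rule prob_space_std_gaussian)
  interpret PP: product_prob_space "\<lambda>_::nat \<times> nat. std_gaussian" "{..<d} \<times> {..<p}" by standard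
  \<comment> \<open>The small ball bound is a power of p t, and p t is at most 1 / (\<tau> d); the 1
    / d left over pays for the union over the d rows.\<close>
  define t where "t = 1 / (\<tau> * (real d)\<^sup>2)"
  define m where "m = p + 1 - q"
  have d: "1 \<le> d" and m: "1 \<le> m" using q by (auto simp: m_def)
  have t: "0 \<le> t" using \<tau> by (simp add: t_def)
  define B where "B l = {g \<in> space G. \<exists>x\<in>PiE {..<q} (\<lambda>_. \<rat>).
    \<forall>j<p. \<bar>\<Sum>a<d. (\<Sum>b<q. x b * w b a) * g (a, j)\<bar> < t * \<bar>\<Sum>b<q. x b * w b l\<bar>}" for l
  define T where "T i = {g \<in> space G. 8 * real d < \<bar>g i\<bar>}" for i
  let ?I = "{..<d} \<times> {..<p}"
  have B: "B l \<in> events" "prob (B l) \<le> (real p * t) ^ m" if "l < d" for l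
    using gaussian_row_small_ball[OF that q(1,2) t, of w] t
    by (auto simp: B_def G_def[symmetric] m_def emeasure_eq_measure)
  have T: "T i \<in> events" "prob (T i) \<le> 2 * exp (1 / 2 - 8 * real d)" if i: "i \<in> ?I" for i
  proof -
    have "emeasure G {x \<in> space G. x i \<in> {y. 8 * real d < \<bar>y\<bar>}} = emeasure std_gaussian {y. 8 * real d < \<bar>y\<bar>}"
      unfolding G_def gaussian_entries_def by (rule PP.emeasure_PiM_Collect_single[OF i]) simp
    then have "emeasure G (T i) \<le> ennreal (2 * exp (1 / 2 - 8 * real d))"
      using std_gaussian_tail[of "8 * real d"] by (simp add: T_def)
    then show "prob (T i) \<le> 2 * exp (1 / 2 - 8 * real d)" by (simp add: emeasure_eq_measure)
    show "T i \<in> events" unfolding T_def G_def gaussian_entries_def using i by measurable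
  qed
  define E where "E = space G - ((\<Union>l<d. B l) \<union> (\<Union>i\<in>?I. T i))"
  have E: "E \<in> events" unfolding E_def using B T by auto
  have "prob (\<Union>l<d. B l) \<le> (\<Sum>l<d. prob (B l))"
    by (rule finite_measure_subadditive_finite) (use B in auto)
  also have "\<dots> \<le> (\<Sum>l<d. (real p * t) ^ m)" by (intro sum_mono B) auto
  also have "\<dots> \<le> real d * (1 / (\<tau> * real d)) ^ m"
  proof -
    have "real p * t \<le> real d * t" using q t by (intro mult_right_mono) auto
    also have "\<dots> = 1 / (\<tau> * real d)" using d by (simp add: t_def power2_eq_square)
    finally show ?thesis using t by (simp add: mult_left_mono power_mono)
  qed
  \<comment> \<open>Since m is at least 1, there is a factor 1 / d available to cancel the number of
    rows.\<close>
  also have "\<dots> = (1 / \<tau>) ^ m * (1 / real d) ^ (m - 1)"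
    using m d by (cases m) (simp_all add: power_divide field_simps)
  also have "\<dots> \<le> (1 / \<tau>) ^ m * 1"
    using \<tau> d by (intro mult_left_mono power_le_one) auto
  also have "\<dots> = \<tau> powr (- real m)"
    using \<tau> by (simp add: powr_minus powr_realpow power_one_over inverse_eq_divide)
  finally have PB: "prob (\<Union>l<d. B l) \<le> \<tau> powr (- real m)" .
  have "prob (\<Union>i\<in>?I. T i) \<le> (\<Sum>i\<in>?I. prob (T i))"
    by (rule finite_measure_subadditive_finite) (use T in auto)
  also have "\<dots> \<le> (\<Sum>i\<in>?I. 2 * exp (1 / 2 - 8 * real d))" by (intro sum_mono T)
  also have "\<dots> = real d * real p * (2 * exp (1 / 2 - 8 * real d))" by simp
  \<comment> \<open>The union over d p entries costs at most exp (2 d) and the factor 2 at most e.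
    The cutoff 8 d leaves the exponent 3 / 2 - 6 d, which is below -d for every d at least
    1.\<close>
  also have "\<dots> \<le> exp (real d) * exp (real d) * (exp 1 * exp (1 / 2 - 8 * real d))"
  proof (intro mult_mono)
    have le: "real d \<le> exp (real d)" using exp_ge_add_one_self[of "real d"] by linarith
    show "real d \<le> exp (real d)" by fact
    show "real p \<le> exp (real d)" using le q by linarith
    show "2 \<le> exp (1 :: real)" using exp_ge_add_one_self[of 1] by simp
  qed auto
  also have "\<dots> = exp (3 / 2 - 6 * real d)" by (simp add: exp_add[symmetric])
  also have "\<dots> \<le> exp (- real d)" using d by simp
  finally have PT: "prob (\<Union>i\<in>?I. T i) \<le> exp (- real d)" .
  have "prob ((\<Union>l<d. B l) \<union> (\<Union>i\<in>?I. T i)) \<le> prob (\<Union>l<d. B l) + prob (\<Union>i\<in>?I. T i)"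
    by (rule measure_Un_le) (use B T in auto)
  moreover have "prob E = 1 - prob ((\<Union>l<d. B l) \<union> (\<Union>i\<in>?I. T i))"
    unfolding E_def by (rule prob_compl) (use B T in auto)
  ultimately have PE: "prob E \<ge> 1 - \<tau> powr (- real m) - exp (- real d)" using PB PT by linarith
  show ?thesis
  proof (rule that[of E])
    show "E \<in> sets (gaussian_entries d p)" using E by (simp add: G_def)
    show "measure (gaussian_entries d p) E \<ge> 1 - \<tau> powr (- real (p + 1 - q)) - exp (- real d)"
      using PE by (simp add: G_def m_def)
    show "\<bar>g (i, j)\<bar> \<le> 8 * real d" if "g \<in> E" "i < d" "j < p" for g i j
      using that by (force simp: E_def T_def not_less)
    show "\<exists>j<p. \<bar>\<Sum>b<q. x b * w b l\<bar> / (\<tau> * (real d)\<^sup>2) \<le> \<bar>\<Sum>a<d. (\<Sum>b<q. x b * w b a) * g (a, j)\<bar>"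
      if g: "g \<in> E" and l: "l < d" for g l x
    proof (rule ccontr)
      assume neg: "\<not> ?thesis"
      have swap: "(\<Sum>a<d. (\<Sum>b<q. y b * w b a) * g (a, j)) = (\<Sum>b<q. y b * (\<Sum>a<d. w b a * g (a, j)))" for y j
        unfolding sum_distrib_left sum_distrib_right by (subst sum.swap) (simp add: mult.assoc)
      \<comment> \<open>A violation by real coefficients is strict, so it passes to rational ones
        and places \<open>g\<close> in the excluded event for row l.\<close>
      have small: "\<bar>\<Sum>b<q. x b * (\<Sum>a<d. w b a * g (a, j))\<bar> < t * \<bar>\<Sum>b<q. x b * w b l\<bar>" if "j < p" for j
        using neg that by (auto simp: not_le swap t_def)
      obtain r where "r \<in> PiE {..<q} (\<lambda>_. \<rat>)"
        "\<And>j. j < p \<Longrightarrow> \<bar>\<Sum>b<q. r b * (\<Sum>a<d. w b a * g (a, j))\<bar> < t * \<bar>\<Sum>b<q. r b * w b l\<bar>"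
        by (rule rational_approximation[where p = p and q = q and x = x and t = t and \<beta> = "\<lambda>b. w b l" and
          f = "\<lambda>j b. \<Sum>a<d. w b a * g (a, j)"]) (rule small, assumption, rule that)
      then have r: "r \<in> PiE {..<q} (\<lambda>_. \<rat>)"
        "\<forall>j<p. \<bar>\<Sum>a<d. (\<Sum>b<q. r b * w b a) * g (a, j)\<bar> < t * \<bar>\<Sum>b<q. r b * w b l\<bar>"
        unfolding swap by blast+
      have "g \<in> space G" using g by (simp add: E_def)
      then have "g \<in> B l" unfolding B_def using r by (intro CollectI conjI bexI[of _ r])
      then show False using g l by (auto simp: E_def)
    qed
  qed
qed

section \<open>Residual of the power iteration\<close>

lemma mat_sum_mult:
  assumes "\<And>i. i < s \<Longrightarrow> A i \<in> carrier_mat d d" "X \<in> carrier_mat d p"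
  shows "mat_sum d p s (\<lambda>i. A i * X) = mat_sum d d s A * X"
proof (rule eq_matI)
  fix a b assume "a < dim_row (mat_sum d d s A * X)" "b < dim_col (mat_sum d d s A * X)"
  then have ab: "a < d" "b < p" using assms(2) by (auto simp: mat_sum_def)
  have "mat_sum d p s (\<lambda>i. A i * X) $$ (a, b) = (\<Sum>i<s. \<Sum>l<d. A i $$ (a, l) * X $$ (l, b))"
  proof -
    have "(A i * X) $$ (a, b) = (\<Sum>l<d. A i $$ (a, l) * X $$ (l, b))" if "i < s" for i
      using ab assms(1)[OF that] assms(2) by (simp add: scalar_prod_def lessThan_atLeast0)
    then show ?thesis using ab by (simp add: mat_sum_def)
  qed
  also have "\<dots> = (\<Sum>l<d. (\<Sum>i<s. A i $$ (a, l)) * X $$ (l, b))"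
    unfolding sum_distrib_right by (rule sum.swap)
  also have "\<dots> = (mat_sum d d s A * X) $$ (a, b)"
    using ab assms(2) by (auto simp: mat_sum_def scalar_prod_def lessThan_atLeast0 intro!: sum.cong)
  finally show "mat_sum d p s (\<lambda>i. A i * X) $$ (a, b) = (mat_sum d d s A * X) $$ (a, b)" .
qed (use assms in \<open>auto simp: mat_sum_def\<close>)

lemma transpose_mat_sum:
  assumes "\<And>i. i < s \<Longrightarrow> A i \<in> carrier_mat d d \<and> transpose_mat (A i) = A i"
  shows "transpose_mat (mat_sum d d s A) = mat_sum d d s A"
proof (rule eq_matI)
  fix a b assume "a < dim_row (mat_sum d d s A)" "b < dim_col (mat_sum d d s A)"
  then have ab: "a < d" "b < d" by (auto simp: mat_sum_def)
  have "A i $$ (b, a) = A i $$ (a, b)" if "i < s" for i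
    using assms[OF that] ab by (metis carrier_matD index_transpose_mat(1))
  then show "transpose_mat (mat_sum d d s A) $$ (a, b) = mat_sum d d s A $$ (a, b)"
    using ab by (simp add: mat_sum_def)
qed (auto simp: mat_sum_def)

lemma scalar_prod_mult_mat_vec:
  fixes M :: "real mat"
  assumes "M \<in> carrier_mat n m" "u \<in> carrier_vec n" "v \<in> carrier_vec m"
  shows "u \<bullet> (M *\<^sub>v v) = (transpose_mat M *\<^sub>v u) \<bullet> v"
  using assms transpose_vec_mult_scalar[of M n m v u] by (simp add: comm_scalar_prod[of _ n])

lemma orthogonal_parseval:
  fixes W :: "real mat"
  assumes W: "W \<in> carrier_mat d d" "transpose_mat W * W = 1\<^sub>m d"
    and uv: "u \<in> carrier_vec d" "v \<in> carrier_vec d"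
  shows "u \<bullet> v = (\<Sum>b<d. (col W b \<bullet> u) * (col W b \<bullet> v))"
proof -
  have WW: "W * transpose_mat W = 1\<^sub>m d"
    using mat_mult_left_right_inverse[of "transpose_mat W" d W] W by simp
  have "u \<bullet> v = u \<bullet> (W *\<^sub>v (transpose_mat W *\<^sub>v v))"
    using W uv WW by (simp add: assoc_mult_mat_vec[symmetric, of W d d _ d])
  also have "\<dots> = (transpose_mat W *\<^sub>v u) \<bullet> (transpose_mat W *\<^sub>v v)"
    using W uv by (intro scalar_prod_mult_mat_vec) auto
  also have "\<dots> = (\<Sum>b<d. (col W b \<bullet> u) * (col W b \<bullet> v))"
    using W uv by (simp add: scalar_prod_def[of "transpose_mat W *\<^sub>v u"] lessThan_atLeast0)
  finally show ?thesis .
qed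

text \<open>If r is orthogonal to the columns of X_l, then A r is orthogonal to those of X_{l-1},
  because (A X_{l-1})^T r = R^T X_l^T r = 0. Descending to X_0 and G = X_0 R shows that A^L r is
  orthogonal to every column of G; the sum is this scalar product in eigenbasis coordinates. The
  argument applies to any choice of QR factors, also when Y_l is rank deficient.\<close>

lemma residual_annihilates_start:
  fixes W :: "real mat" and \<mu> :: "nat \<Rightarrow> real"
  assumes A: "\<And>i. i < s \<Longrightarrow> A i \<in> carrier_mat d d \<and> transpose_mat (A i) = A i"
    and W: "W \<in> carrier_mat d d" "transpose_mat W * W = 1\<^sub>m d"
    and eig: "\<And>b. b < d \<Longrightarrow> mat_sum d d s A *\<^sub>v col W b = \<mu> b \<cdot>\<^sub>v col W b"
    and run: "distributed_power_run d p s A G L X" and G: "G \<in> carrier_mat d p"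
    and r: "r \<in> carrier_vec d" "transpose_mat (X L) *\<^sub>v r = 0\<^sub>v p" and j: "j < p"
  shows "(\<Sum>b<d. \<mu> b ^ L * (col W b \<bullet> r) * (col W b \<bullet> col G j)) = 0"
proof -
  define S where "S = mat_sum d d s A"
  have S: "S \<in> carrier_mat d d" "transpose_mat S = S"
    using transpose_mat_sum[OF A] by (auto simp: S_def mat_sum_def)
  have "(\<Sum>b<d. \<mu> b ^ l * (col W b \<bullet> r) * (col W b \<bullet> col G j)) = 0"
    if "l \<le> L" "r \<in> carrier_vec d" "transpose_mat (X l) *\<^sub>v r = 0\<^sub>v p" for l r
    using that
  proof (induction l arbitrary: r)
    case 0
    obtain R where R: "X 0 \<in> carrier_mat d p" "R \<in> carrier_mat p p" "G = X 0 * R"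
      using run by (auto simp: distributed_power_run_def qr_factor_def)
    have colG: "col G j = X 0 *\<^sub>v col R j" unfolding R(3) using R j by (intro col_mult2) auto
    have "(\<Sum>b<d. \<mu> b ^ 0 * (col W b \<bullet> r) * (col W b \<bullet> col G j)) = r \<bullet> col G j"
      using orthogonal_parseval[OF W 0(2), of "col G j"] G j by simp
    also have "\<dots> = (transpose_mat (X 0) *\<^sub>v r) \<bullet> col R j"
      unfolding colG using R j 0(2) by (intro scalar_prod_mult_mat_vec) auto
    also have "\<dots> = 0" using 0(3) R j by simp
    finally show ?case .
  next
    case (Suc l)
    have "qr_factor d p (mat_sum d p s (\<lambda>i. A i * X l)) (X (Suc l))"
      using run Suc.prems(1) by (force simp: distributed_power_run_def)
    moreover have Xl: "X l \<in> carrier_mat d p"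
    proof (cases l)
      case 0
      then show ?thesis using run by (auto simp: distributed_power_run_def qr_factor_def)
    next
      case (Suc l')
      then show ?thesis using run \<open>Suc l \<le> L\<close> by (auto simp: distributed_power_run_def qr_factor_def)
    qed
    ultimately obtain R where R: "X (Suc l) \<in> carrier_mat d p" "R \<in> carrier_mat p p" "S * X l = X (Suc l) * R"
      using mat_sum_mult[of s A d "X l" p] A by (auto simp: qr_factor_def S_def)
    have "transpose_mat (X l) *\<^sub>v (S *\<^sub>v r) = transpose_mat (S * X l) *\<^sub>v r"
      using S Xl Suc.prems(2) by (simp add: transpose_mult[of _ d d _ p] assoc_mult_mat_vec[of _ p d _ d])
    also have "\<dots> = transpose_mat R *\<^sub>v (transpose_mat (X (Suc l)) *\<^sub>v r)"
      unfolding R(3) using R Suc.prems(2) by (simp add: transpose_mult[of _ d p _ p] assoc_mult_mat_vec[of _ p p _ d])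
    also have "\<dots> = 0\<^sub>v p" unfolding Suc.prems(3) using R by auto
    finally have "(\<Sum>b<d. \<mu> b ^ l * (col W b \<bullet> (S *\<^sub>v r)) * (col W b \<bullet> col G j)) = 0"
      using Suc.IH[of "S *\<^sub>v r"] Suc.prems S by auto
    moreover have "col W b \<bullet> (S *\<^sub>v r) = \<mu> b * (col W b \<bullet> r)" if "b < d" for b
    proof -
      have "col W b \<bullet> (S *\<^sub>v r) = (S *\<^sub>v col W b) \<bullet> r"
        using scalar_prod_mult_mat_vec[of S d d "col W b" r] S W that Suc.prems(2) by simp
      then show ?thesis using eig[OF that] W Suc.prems(2) that by (simp add: S_def)
    qed
    ultimately show ?case by (simp add: mult.assoc mult.left_commute)
  qed
  from this[OF order_refl r] show ?thesis .
qed

text \<open>The deterministic estimate in eigenbasis coordinates: \<alpha> is the residual,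
  \<upsilon> the vector in the span of U, \<open>\<gamma> b j\<close> the pairing of eigenvector b
  with column j of G, \<open>w b l\<close> entry l of eigenvector b, and s, s' are \<sigma>_k,
  \<sigma>_{q+1}. The bound is relative to the residual itself, so one factor of its norm cancels at
  the end.\<close>

lemma spectral_residual_bound:
  fixes \<mu> \<alpha> \<upsilon> :: "nat \<Rightarrow> real" and \<gamma> w :: "nat \<Rightarrow> nat \<Rightarrow> real"
  assumes q: "q \<le> d" and \<mu>: "\<And>b. b < d \<Longrightarrow> 0 \<le> \<mu> b" "\<And>b. q \<le> b \<Longrightarrow> b < d \<Longrightarrow> \<mu> b \<le> s'"
    and s: "0 \<le> s'" "s' < s"
    and \<upsilon>: "\<And>b. b < d \<Longrightarrow> \<upsilon> b \<noteq> 0 \<Longrightarrow> s \<le> \<mu> b" "L2_set \<upsilon> {..<d} \<le> 1"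
    and \<alpha>\<upsilon>: "(\<Sum>b<d. (\<alpha> b)\<^sup>2) = (\<Sum>b<d. \<alpha> b * \<upsilon> b)"
    and zero: "\<And>j. j < p \<Longrightarrow> (\<Sum>b<d. \<mu> b ^ L * \<alpha> b * \<gamma> b j) = 0"
    and lower: "\<And>x l. l < d \<Longrightarrow> \<exists>j<p. \<bar>\<Sum>b<q. x b * w b l\<bar> \<le> \<kappa> * \<bar>\<Sum>b<q. x b * \<gamma> b j\<bar>"
    and K: "\<And>j. j < p \<Longrightarrow> L2_set (\<lambda>b. \<gamma> b j) {..<d} \<le> K" and \<kappa>: "0 \<le> \<kappa>"
    and orth: "\<And>x. (\<Sum>l<d. (\<Sum>b<q. x b * w b l)\<^sup>2) = (\<Sum>b<q. (x b)\<^sup>2)"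
  shows "L2_set \<alpha> {..<d} \<le> sqrt (real d) * \<kappa> * K * (s' / s) ^ L"
proof -
  define y where "y b = \<mu> b ^ L * \<alpha> b" for b
  define n where "n = L2_set \<alpha> {..<d}"
  have split: "{..<d} = {..<q} \<union> {q..<d}" using q by auto
  have sub: "L2_set f {q..<d} \<le> L2_set f {..<d}" "L2_set f {..<q} \<le> L2_set f {..<d}" for f :: "nat \<Rightarrow> real"
    unfolding L2_set_def using q by (auto intro!: sum_mono2)
  have n: "0 \<le> n" by (simp add: n_def)
  have yT: "L2_set y {q..<d} \<le> s' ^ L * n"
  proof -
    have "L2_set y {q..<d} = L2_set (\<lambda>b. \<bar>y b\<bar>) {q..<d}" by (simp add: L2_set_def)
    also have "\<dots> \<le> L2_set (\<lambda>b. s' ^ L * \<bar>\<alpha> b\<bar>) {q..<d}"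
      by (intro L2_set_mono) (auto simp: y_def abs_mult power_abs \<mu> intro!: mult_right_mono power_mono)
    also have "\<dots> = s' ^ L * L2_set (\<lambda>b. \<bar>\<alpha> b\<bar>) {q..<d}"
      using s by (simp add: L2_set_right_distrib)
    also have "L2_set (\<lambda>b. \<bar>\<alpha> b\<bar>) {q..<d} = L2_set \<alpha> {q..<d}" by (simp add: L2_set_def)
    also have "s' ^ L * \<dots> \<le> s' ^ L * n" unfolding n_def using s sub by (intro mult_left_mono) auto
    finally show ?thesis .
  qed
  have Yl: "\<bar>\<Sum>b<q. y b * w b l\<bar> \<le> \<kappa> * (s' ^ L * n * K)" if l: "l < d" for l
  proof -
    obtain j where j: "j < p" "\<bar>\<Sum>b<q. y b * w b l\<bar> \<le> \<kappa> * \<bar>\<Sum>b<q. y b * \<gamma> b j\<bar>" using lower[OF l] by blast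
    have "(\<Sum>b<q. y b * \<gamma> b j) + (\<Sum>b=q..<d. y b * \<gamma> b j) = (\<Sum>b<d. y b * \<gamma> b j)"
      unfolding split by (rule sum.union_disjoint[symmetric]) auto
    then have "\<bar>\<Sum>b<q. y b * \<gamma> b j\<bar> = \<bar>\<Sum>b=q..<d. y b * \<gamma> b j\<bar>" using zero[OF j(1)] by (simp add: y_def)
    also have "\<dots> \<le> (\<Sum>b=q..<d. \<bar>y b * \<gamma> b j\<bar>)" by (rule sum_abs)
    also have "\<dots> \<le> L2_set y {q..<d} * L2_set (\<lambda>b. \<gamma> b j) {q..<d}"
      unfolding abs_mult by (rule L2_set_mult_ineq)
    also have "\<dots> \<le> s' ^ L * n * K"
      using yT K[OF j(1)] sub(1)[of "\<lambda>b. \<gamma> b j"] s n by (intro mult_mono) auto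
    finally show ?thesis using j(2) \<kappa> by (meson mult_left_mono order_trans)
  qed
  \<comment> \<open>The lower bound on G^T speaks of entries in the standard basis. Orthonormality
    of the eigenvectors transfers the norm there, and d entries of equal bound cost sqrt d.\<close>
  have "L2_set y {..<q} = L2_set (\<lambda>l. \<bar>\<Sum>b<q. y b * w b l\<bar>) {..<d}"
    by (simp add: L2_set_def orth)
  also have "\<dots> \<le> L2_set (\<lambda>l. \<kappa> * (s' ^ L * n * K)) {..<d}"
    by (intro L2_set_mono Yl) auto
  also have "\<dots> = sqrt (real d) * \<bar>\<kappa> * (s' ^ L * n * K)\<bar>"
    by (simp add: L2_set_def real_sqrt_mult)
  also have "\<dots> = sqrt (real d) * (\<kappa> * (s' ^ L * n * K))"
  proof (cases "d = 0")
    case False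
    then have "0 \<le> \<kappa> * (s' ^ L * n * K)" using Yl[of 0] by (smt (verit) abs_ge_zero gr0I)
    then show ?thesis by simp
  qed simp
  finally have yS: "L2_set y {..<q} \<le> sqrt (real d) * (\<kappa> * (s' ^ L * n * K))" .
  \<comment> \<open>Eigenvalues beyond the first q stay below s, so \<upsilon> has no coordinates
    there and only the top part of \<open>y\<close> pairs with it.\<close>
  have zero_tail: "\<upsilon> b = 0" if "q \<le> b" "b < d" for b
    using \<upsilon>(1)[OF that(2)] \<mu>(2)[OF that] s by force
  have "s ^ L * n\<^sup>2 = s ^ L * (\<Sum>b<d. \<alpha> b * \<upsilon> b)"
    by (simp add: n_def L2_set_def \<alpha>\<upsilon>[symmetric] sum_nonneg)
  also have "(\<Sum>b<d. \<alpha> b * \<upsilon> b) = (\<Sum>b<q. \<alpha> b * \<upsilon> b) + (\<Sum>b=q..<d. \<alpha> b * \<upsilon> b)"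
    unfolding split by (rule sum.union_disjoint) auto
  also have "(\<Sum>b=q..<d. \<alpha> b * \<upsilon> b) = 0" using zero_tail by (intro sum.neutral) auto
  also have "s ^ L * ((\<Sum>b<q. \<alpha> b * \<upsilon> b) + 0) = (\<Sum>b<q. s ^ L * (\<alpha> b * \<upsilon> b))" by (simp add: sum_distrib_left)
  \<comment> \<open>This takes the place of applying A^{-L}: where \<upsilon> is nonzero, the L-th
    power of the eigenvalue is at least \<open>s ^ L\<close>.\<close>
  also have "\<dots> \<le> (\<Sum>b<q. \<bar>y b\<bar> * \<bar>\<upsilon> b\<bar>)"
  proof (rule sum_mono)
    fix b assume "b \<in> {..<q}"
    then have b: "b < d" using q by auto
    show "s ^ L * (\<alpha> b * \<upsilon> b) \<le> \<bar>y b\<bar> * \<bar>\<upsilon> b\<bar>"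
    proof (cases "\<upsilon> b = 0")
      case False
      then have "s ^ L \<le> \<mu> b ^ L" using \<upsilon>(1)[OF b] s by (intro power_mono) auto
      then have "s ^ L * \<bar>\<alpha> b * \<upsilon> b\<bar> \<le> \<mu> b ^ L * \<bar>\<alpha> b * \<upsilon> b\<bar>" by (intro mult_right_mono) auto
      moreover have "s ^ L * (\<alpha> b * \<upsilon> b) \<le> s ^ L * \<bar>\<alpha> b * \<upsilon> b\<bar>" using s by (intro mult_left_mono) auto
      ultimately show ?thesis using \<mu>(1)[OF b] by (simp add: y_def abs_mult mult.assoc)
    qed simp
  qed
  also have "\<dots> \<le> L2_set y {..<q} * L2_set \<upsilon> {..<q}" by (rule L2_set_mult_ineq)
  also have "\<dots> \<le> L2_set y {..<q} * 1"
    using \<upsilon>(2) sub(2)[of \<upsilon>] by (intro mult_left_mono) auto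
  finally have "s ^ L * n * n \<le> (sqrt (real d) * \<kappa> * K * s' ^ L) * n"
    using yS by (simp add: power2_eq_square mult_ac)
  show ?thesis
  proof (cases "n = 0")
    case True
    \<comment> \<open>Nothing can be cancelled when the residual is zero, so the right-hand side has
      to be shown nonnegative. Applying \<open>lower\<close> to zero coefficients produces a column
      index, and K bounds a norm.\<close>
    have "0 \<le> K" if d: "0 < d"
    proof -
      obtain j where "j < p" using lower[OF d, of "\<lambda>_. 0"] by blast
      from K[OF this] show ?thesis by (meson L2_set_nonneg order_trans)
    qed
    then have "0 \<le> sqrt (real d) * \<kappa> * K * (s' / s) ^ L" using \<kappa> s by (cases "d = 0") auto
    then show ?thesis using True by (simp add: n_def)
  next
    case False
    then have "0 < n" using n by simp
    then have "s ^ L * n \<le> sqrt (real d) * \<kappa> * K * s' ^ L"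
      using \<open>s ^ L * n * n \<le> _\<close> by simp
    then show ?thesis using s by (simp add: n_def power_divide field_simps)
  qed
qed

text \<open>
  For \<open>d \<ge> 2\<close> the prefactor \<open>8 \<tau> d\<^sup>5\<close> is at most \<open>d\<close> to the power \<open>8 + ln \<tau> / ln 2\<close>.
\<close>

lemma iteration_count_suffices:
  fixes s s' \<tau> \<epsilon> :: real
  assumes \<tau>: "1 < \<tau>" and d: "2 \<le> d" and s: "0 \<le> s'" "s' < s" and \<epsilon>: "0 < \<epsilon>" "\<epsilon> < 1"
    and L: "(8 + ln \<tau> / ln 2) * (s / (s - s') * ln (real d / \<epsilon>)) \<le> real L"
  shows "8 * \<tau> * real d ^ 5 * (s' / s) ^ L \<le> \<epsilon>"
proof -
  define \<rho> where "\<rho> = s' / s"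
  define C where "C = 8 + ln \<tau> / ln 2"
  have \<rho>: "0 \<le> \<rho>" using s by (simp add: \<rho>_def)
  \<comment> \<open>The factor \<open>s / (s - s')\<close> is the reciprocal of
    \<open>1 - \<rho>\<close>.\<close>
  have gap: "s / (s - s') * (1 - \<rho>) = 1" using s by (simp add: \<rho>_def field_simps)
  have "\<rho> < 1" using s by (simp add: \<rho>_def)
  have "C * ln (real d / \<epsilon>) = C * (s / (s - s') * ln (real d / \<epsilon>)) * (1 - \<rho>)"
    using gap by (metis mult.assoc mult.commute mult.left_neutral)
  also have "\<dots> \<le> real L * (1 - \<rho>)" using L \<open>\<rho> < 1\<close> by (intro mult_right_mono) (auto simp: C_def)
  finally have L': "C * (ln (real d) - ln \<epsilon>) \<le> real L * (1 - \<rho>)" using \<epsilon> d by (simp add: ln_div)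
  \<comment> \<open>Estimating \<rho> by exp (\<rho> - 1) instead of taking its logarithm covers
    \<rho> = 0 as well.\<close>
  have "\<rho> ^ L \<le> exp (\<rho> - 1) ^ L"
    using \<rho> exp_ge_add_one_self[of "\<rho> - 1"] by (intro power_mono) auto
  also have "\<dots> = exp (- (real L * (1 - \<rho>)))" by (simp add: exp_of_nat_mult[symmetric] algebra_simps)
  finally have pow: "\<rho> ^ L \<le> exp (- (real L * (1 - \<rho>)))" .
  have ln2: "ln 2 \<le> ln (real d)" "0 < ln (2 :: real)" using d by auto
  have const: "8 * \<tau> * real d ^ 5 = exp (3 * ln 2 + ln \<tau> + 5 * ln (real d))"
    using \<tau> d by (simp add: exp_add exp_of_nat_mult[of 3, simplified] exp_of_nat_mult[of 5, simplified])
  have "8 * \<tau> * real d ^ 5 * \<rho> ^ L \<le> exp (3 * ln 2 + ln \<tau> + 5 * ln (real d)) * exp (- (real L * (1 - \<rho>)))"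
    unfolding const by (intro mult_left_mono pow) auto
  also have "\<dots> = exp (3 * ln 2 + ln \<tau> + 5 * ln (real d) - real L * (1 - \<rho>))" by (simp add: exp_add[symmetric])
  also have "\<dots> \<le> exp (ln \<epsilon>)"
  proof -
    have "ln \<tau> = ln \<tau> / ln 2 * ln 2" using ln2 by simp
    also have "\<dots> \<le> ln \<tau> / ln 2 * ln (real d)" using ln2 \<tau> by (intro mult_left_mono) auto
    finally have "3 * ln 2 + ln \<tau> + 5 * ln (real d) \<le> C * ln (real d)"
      using ln2 by (simp add: C_def distrib_right)
    \<comment> \<open>The logarithm of \<epsilon> is negative and C is at least 1.\<close>
    moreover have "C * ln \<epsilon> \<le> 1 * ln \<epsilon>"
      using \<epsilon> \<tau> ln2 by (intro mult_right_mono_neg) (auto simp: C_def add_increasing2)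
    ultimately have "3 * ln 2 + ln \<tau> + 5 * ln (real d) - real L * (1 - \<rho>) \<le> ln \<epsilon>"
      using L' by (simp add: right_diff_distrib)
    then show ?thesis by simp
  qed
  also have "exp (ln \<epsilon>) = \<epsilon>" using \<epsilon> by simp
  finally show ?thesis by (simp add: \<rho>_def)
qed

section \<open>From coordinates back to matrices, and the conclusion\<close>

lemma spectral_norm_le:
  assumes "\<And>v. v \<in> carrier_vec (dim_col M) \<Longrightarrow> vec_norm2 v \<le> 1 \<Longrightarrow> vec_norm2 (M *\<^sub>v v) \<le> c"
  shows "spectral_norm M \<le> c"
  unfolding spectral_norm_def
proof (rule cSup_least)
  have "vec_norm2 (0\<^sub>v (dim_col M)) \<le> 1" by (simp add: vec_norm2_def)
  then show "{vec_norm2 (M *\<^sub>v v) |v. v \<in> carrier_vec (dim_col M) \<and> vec_norm2 v \<le> 1} \<noteq> {}"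
    using zero_carrier_vec by blast
qed (use assms in auto)

lemma vec_norm2_eq_L2_set:
  fixes W :: "real mat"
  assumes "W \<in> carrier_mat d d" "transpose_mat W * W = 1\<^sub>m d" "v \<in> carrier_vec d"
  shows "vec_norm2 v = L2_set (\<lambda>b. col W b \<bullet> v) {..<d}"
  unfolding vec_norm2_def L2_set_def orthogonal_parseval[OF assms assms(3)] by (simp add: power2_eq_square)

lemma ordered_eigenbasis:
  assumes A: "A \<in> carrier_mat d d" "transpose_mat A = A" and ev: "ordered_eigenvalues d A \<sigma>"
  obtains W where "W \<in> carrier_mat d d" "transpose_mat W * W = 1\<^sub>m d"
    "\<And>b. b < d \<Longrightarrow> A *\<^sub>v col W b = \<sigma> (b + 1) \<cdot>\<^sub>v col W b"
proof -
  have "(\<Prod>i=1..d. [:- \<sigma> i, 1:]) = (\<Prod>e\<leftarrow>map \<sigma> [1..<Suc d]. [:- e, 1:])"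
    by (simp add: prod.distinct_set_conv_list[symmetric] comp_def atLeastLessThanSuc_atLeastAtMost del: upt_Suc)
  then have "char_poly A = (\<Prod>e\<leftarrow>map \<sigma> [1..<Suc d]. [:- e, 1:])"
    using ev by (simp add: ordered_eigenvalues_def)
  from symmetric_mat_diagonalization[OF A this] obtain W where W: "W \<in> carrier_mat d d" "transpose_mat W * W = 1\<^sub>m d"
    "transpose_mat W * A * W = mat d d (\<lambda>(i,j). if i = j then map \<sigma> [1..<Suc d] ! i else 0)" by auto
  have WW: "W * transpose_mat W = 1\<^sub>m d"
    using mat_mult_left_right_inverse[of "transpose_mat W" d W] W by simp
  have WT: "transpose_mat W \<in> carrier_mat d d" using W by simp
  define D where "D = mat d d (\<lambda>(i,j). if i = j then \<sigma> (i + 1) else 0)"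
  have "transpose_mat W * A * W = D"
    unfolding W(3) D_def by (intro cong_mat) (auto simp del: upt_Suc)
  then have "W * D = W * (transpose_mat W * A * W)" by simp
  also have "\<dots> = (W * transpose_mat W) * (A * W)"
    using W(1) WT A(1) by (simp add: assoc_mult_mat[of _ d d _ d _ d] mult_carrier_mat)
  also have "\<dots> = A * W" unfolding WW using W(1) A(1) by simp
  finally have AW: "A * W = W * D" by simp
  show ?thesis
  proof (rule that[OF W(1,2)])
    fix b assume b: "b < d"
    have "A *\<^sub>v col W b = col (W * D) b" using AW A W b by (metis col_mult2)
    also have "\<dots> = \<sigma> (b + 1) \<cdot>\<^sub>v col W b"
    proof (rule eq_vecI)
      fix i assume "i < dim_vec (\<sigma> (b + 1) \<cdot>\<^sub>v col W b)"
      then have i: "i < d" using W by simp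
      have "col (W * D) b $ i = (\<Sum>l<d. W $$ (i, l) * (if l = b then \<sigma> (l + 1) else 0))"
        using i b W by (simp add: D_def scalar_prod_def lessThan_atLeast0)
      also have "\<dots> = (\<Sum>l<d. if l = b then W $$ (i, l) * \<sigma> (l + 1) else 0)" by (intro sum.cong) auto
      also have "\<dots> = W $$ (i, b) * \<sigma> (b + 1)" using b by simp
      finally show "col (W * D) b $ i = (\<sigma> (b + 1) \<cdot>\<^sub>v col W b) $ i" using i b W by simp
    qed (use W in \<open>simp add: D_def\<close>)
    finally show "A *\<^sub>v col W b = \<sigma> (b + 1) \<cdot>\<^sub>v col W b" .
  qed
qed

lemma eigenvectors_orthogonal:
  fixes A :: "real mat"
  assumes A: "A \<in> carrier_mat d d" "transpose_mat A = A" and uv: "u \<in> carrier_vec d" "v \<in> carrier_vec d"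
    and eig: "A *\<^sub>v u = a \<cdot>\<^sub>v u" "A *\<^sub>v v = b \<cdot>\<^sub>v v" and "a \<noteq> b"
  shows "u \<bullet> v = 0"
proof -
  have "b * (u \<bullet> v) = u \<bullet> (A *\<^sub>v v)" using eig uv by simp
  also have "\<dots> = (A *\<^sub>v u) \<bullet> v" using scalar_prod_mult_mat_vec[OF A(1) uv] A(2) by simp
  also have "\<dots> = a * (u \<bullet> v)" using eig uv by simp
  finally show ?thesis using \<open>a \<noteq> b\<close> by simp
qed

text \<open>For a unit ball vector v, the residual r of u = U v is an orthogonal projection of u,
  which gives both X_L^T r = 0 and <r, r> = <r, u>. With repeated eigenvalues the columns of U need
  not be among those of W; the two bases are linked only by the orthogonality of eigenvectors for
  different eigenvalues.\<close>

lemma power_run_residual_norm: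
  fixes W U :: "real mat"
  assumes kqp: "1 \<le> k" "k \<le> q" "q \<le> p" "p \<le> d"
    and A: "\<And>i. i < s \<Longrightarrow> A i \<in> carrier_mat d d \<and> transpose_mat (A i) = A i"
    and ev: "ordered_eigenvalues d (mat_sum d d s A) \<sigma>"
    and U: "top_eigenvectors d k (mat_sum d d s A) \<sigma> U"
    and gap: "\<sigma> (q + 1) < \<sigma> k"
    and W: "W \<in> carrier_mat d d" "transpose_mat W * W = 1\<^sub>m d"
    and eig: "\<And>b. b < d \<Longrightarrow> mat_sum d d s A *\<^sub>v col W b = \<sigma> (b + 1) \<cdot>\<^sub>v col W b"
    and \<tau>: "1 < \<tau>"
    and g: "\<And>i j. i < d \<Longrightarrow> j < p \<Longrightarrow> \<bar>g (i, j)\<bar> \<le> 8 * real d"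
      "\<And>l x. l < d \<Longrightarrow> \<exists>j<p. \<bar>\<Sum>b<q. x b * W $$ (l, b)\<bar> / (\<tau> * (real d)\<^sup>2)
        \<le> \<bar>\<Sum>a<d. (\<Sum>b<q. x b * W $$ (a, b)) * g (a, j)\<bar>"
    and run: "distributed_power_run d p s A (mat d p g) L X"
  shows "spectral_norm ((1\<^sub>m d - X L * transpose_mat (X L)) * U) \<le> 8 * \<tau> * real d ^ 5 * (\<sigma> (q + 1) / \<sigma> k) ^ L"
proof (rule spectral_norm_le)
  define S where "S = mat_sum d d s A"
  have S: "S \<in> carrier_mat d d" "transpose_mat S = S"
    using transpose_mat_sum[OF A] by (auto simp: S_def mat_sum_def)
  have anti: "\<sigma> j \<le> \<sigma> i" if "1 \<le> i" "i \<le> j" "j \<le> d" for i j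
    using ev that by (auto simp: ordered_eigenvalues_def monotone_on_def)
  have nonneg: "0 \<le> \<sigma> i" if "1 \<le> i" "i \<le> d + 1" for i
    using ev that by (cases "i = d + 1") (auto simp: ordered_eigenvalues_def)
  have d: "1 \<le> d" using kqp by simp
  have X: "X L \<in> carrier_mat d p" "transpose_mat (X L) * X L = 1\<^sub>m p"
  proof -
    have "\<exists>Y. qr_factor d p Y (X L)"
    proof (cases L)
      case 0
      then show ?thesis using run by (auto simp: distributed_power_run_def)
    next
      case (Suc L')
      then have "L \<in> {1..L}" by simp
      then show ?thesis using run unfolding distributed_power_run_def by blast
    qed
    then show "X L \<in> carrier_mat d p" "transpose_mat (X L) * X L = 1\<^sub>m p"
      by (auto simp: qr_factor_def orthonormal_cols_def)
  qed
  have Uc: "U \<in> carrier_mat d k" "transpose_mat U * U = 1\<^sub>m k"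
    and Ueig: "\<And>j. j < k \<Longrightarrow> S *\<^sub>v col U j = \<sigma> (j + 1) \<cdot>\<^sub>v col U j"
    using U by (auto simp: top_eigenvectors_def orthonormal_cols_def eigenvector_def S_def)
  define M where "M = (1\<^sub>m d - X L * transpose_mat (X L)) * U"
  fix v assume "v \<in> carrier_vec (dim_col ((1\<^sub>m d - X L * transpose_mat (X L)) * U))" and v1: "vec_norm2 v \<le> 1"
  then have v: "v \<in> carrier_vec k" using Uc by simp
  define u where "u = U *\<^sub>v v"
  have u: "u \<in> carrier_vec d" using Uc v by (simp add: u_def)
  have P: "1\<^sub>m d - X L * transpose_mat (X L) \<in> carrier_mat d d"
    using X by (intro minus_carrier_mat mult_carrier_mat[of _ d p]) auto
  define r where "r = (1\<^sub>m d - X L * transpose_mat (X L)) *\<^sub>v u"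
  have r: "r \<in> carrier_vec d" unfolding r_def by (rule mult_mat_vec_carrier[OF P u])
  have Mv: "M *\<^sub>v v = r"
    unfolding M_def r_def u_def by (rule assoc_mult_mat_vec[OF P Uc(1) v])
  have XTu: "transpose_mat (X L) *\<^sub>v u \<in> carrier_vec p" using X u by simp
  have r_eq: "r = u - X L *\<^sub>v (transpose_mat (X L) *\<^sub>v u)"
    using X u by (simp add: r_def minus_mult_distrib_mat_vec[of _ d d] assoc_mult_mat_vec[of _ d p _ d])
  have Xr: "transpose_mat (X L) *\<^sub>v r = 0\<^sub>v p"
  proof -
    have "transpose_mat (X L) *\<^sub>v r = transpose_mat (X L) *\<^sub>v u - transpose_mat (X L) *\<^sub>v (X L *\<^sub>v (transpose_mat (X L) *\<^sub>v u))"
      unfolding r_eq using X u XTu by (intro mult_minus_distrib_mat_vec) auto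
    also have "transpose_mat (X L) *\<^sub>v (X L *\<^sub>v (transpose_mat (X L) *\<^sub>v u)) = (transpose_mat (X L) * X L) *\<^sub>v (transpose_mat (X L) *\<^sub>v u)"
      using X XTu by (intro assoc_mult_mat_vec[symmetric]) auto
    also have "\<dots> = transpose_mat (X L) *\<^sub>v u" unfolding X(2) using XTu by simp
    finally show ?thesis using XTu by simp
  qed
  have rr: "r \<bullet> r = r \<bullet> u"
  proof -
    have "r \<bullet> r = r \<bullet> u - r \<bullet> (X L *\<^sub>v (transpose_mat (X L) *\<^sub>v u))"
      by (subst (2) r_eq) (use X r u XTu in \<open>intro scalar_prod_minus_distrib, auto\<close>)
    also have "r \<bullet> (X L *\<^sub>v (transpose_mat (X L) *\<^sub>v u)) = (transpose_mat (X L) *\<^sub>v r) \<bullet> (transpose_mat (X L) *\<^sub>v u)"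
      using X r XTu by (intro scalar_prod_mult_mat_vec) auto
    also have "\<dots> = 0" unfolding Xr using XTu by simp
    finally show ?thesis by simp
  qed
  have uu: "vec_norm2 u = vec_norm2 v"
  proof -
    have "u \<bullet> u = (transpose_mat U *\<^sub>v u) \<bullet> v"
      by (subst (2) u_def) (use Uc u v in \<open>intro scalar_prod_mult_mat_vec, auto\<close>)
    also have "transpose_mat U *\<^sub>v u = (transpose_mat U * U) *\<^sub>v v"
      unfolding u_def using Uc v by (intro assoc_mult_mat_vec[symmetric]) auto
    also have "\<dots> = v" unfolding Uc(2) using v by simp
    finally show ?thesis by (simp add: vec_norm2_def)
  qed
  have col: "col W b \<in> carrier_vec d" if "b < d" for b using W that by simp
  \<comment> \<open>An eigenvector in W with eigenvalue below \<sigma>_k is orthogonal to all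
    columns of U, whose eigenvalues are at least \<sigma>_k, and hence to u.\<close>
  have large: "\<sigma> k \<le> \<sigma> (b + 1)" if b: "b < d" and nz: "col W b \<bullet> u \<noteq> 0" for b
  proof (rule ccontr)
    assume small: "\<not> ?thesis"
    have "transpose_mat U *\<^sub>v col W b = 0\<^sub>v k"
    proof (rule eq_vecI)
      fix j assume "j < dim_vec (0\<^sub>v k :: real vec)"
      then have j: "j < k" by simp
      have "\<sigma> k \<le> \<sigma> (j + 1)" using anti[of "j + 1" k] j kqp by simp
      then have "\<sigma> (j + 1) \<noteq> \<sigma> (b + 1)" using small by simp
      then have "col U j \<bullet> col W b = 0"
        using eigenvectors_orthogonal[OF S, of "col U j" "col W b"] Ueig[OF j] eig[OF b] col[OF b] Uc(1) j
        by (simp add: S_def)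
      then show "(transpose_mat U *\<^sub>v col W b) $ j = 0\<^sub>v k $ j" using Uc j by simp
    qed (use Uc in simp)
    then have "col W b \<bullet> u = 0"
      unfolding u_def using scalar_prod_mult_mat_vec[OF Uc(1) col[OF b] v] v by simp
    then show False using nz by simp
  qed
  define \<gamma> where "\<gamma> b j = col W b \<bullet> col (mat d p g) j" for b j
  have \<gamma>_sum: "\<gamma> b j = (\<Sum>a<d. W $$ (a, b) * g (a, j))" if "b < d" "j < p" for b j
    using that W by (simp add: \<gamma>_def scalar_prod_def lessThan_atLeast0)
  \<comment> \<open>The factor \<open>\<tau> * (real d)\<^sup>2\<close> is the loss of G^T on S;
    \<open>sqrt (real d) * (8 * real d)\<close> bounds the norm of a column of G with d entries of
    modulus at most 8 d.\<close>
  have "L2_set (\<lambda>b. col W b \<bullet> r) {..<d} \<le> sqrt (real d) * (\<tau> * (real d)\<^sup>2) * (sqrt (real d) * (8 * real d)) * (\<sigma> (q + 1) / \<sigma> k) ^ L"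
  proof (rule spectral_residual_bound[where q = q and \<mu> = "\<lambda>b. \<sigma> (b + 1)" and \<upsilon> = "\<lambda>b. col W b \<bullet> u"
        and p = p and \<gamma> = \<gamma> and w = "\<lambda>b l. W $$ (l, b)"])
    show "q \<le> d" using kqp by simp
    show "0 \<le> \<sigma> (b + 1)" if "b < d" for b using that nonneg by simp
    show "\<sigma> (b + 1) \<le> \<sigma> (q + 1)" if "q \<le> b" "b < d" for b using that anti by simp
    show "0 \<le> \<sigma> (q + 1)" using nonneg kqp by simp
    show "\<sigma> (q + 1) < \<sigma> k" by (rule gap)
    show "\<sigma> k \<le> \<sigma> (b + 1)" if "b < d" "col W b \<bullet> u \<noteq> 0" for b using large that by simp
    show "L2_set (\<lambda>b. col W b \<bullet> u) {..<d} \<le> 1"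
      using vec_norm2_eq_L2_set[OF W u] uu v1 by simp
    show "(\<Sum>b<d. (col W b \<bullet> r)\<^sup>2) = (\<Sum>b<d. (col W b \<bullet> r) * (col W b \<bullet> u))"
      using rr orthogonal_parseval[OF W r r] orthogonal_parseval[OF W r u] by (simp add: power2_eq_square)
    show "(\<Sum>b<d. \<sigma> (b + 1) ^ L * (col W b \<bullet> r) * \<gamma> b j) = 0" if "j < p" for j
      unfolding \<gamma>_def by (rule residual_annihilates_start[OF A W eig run _ r Xr that]) auto
    show "\<exists>j<p. \<bar>\<Sum>b<q. x b * W $$ (l, b)\<bar> \<le> \<tau> * (real d)\<^sup>2 * \<bar>\<Sum>b<q. x b * \<gamma> b j\<bar>" if l: "l < d" for x l
    proof -
      obtain j where j: "j < p" "\<bar>\<Sum>b<q. x b * W $$ (l, b)\<bar> / (\<tau> * (real d)\<^sup>2)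
        \<le> \<bar>\<Sum>a<d. (\<Sum>b<q. x b * W $$ (a, b)) * g (a, j)\<bar>" using g(2)[OF l] by blast
      have "(\<Sum>a<d. (\<Sum>b<q. x b * W $$ (a, b)) * g (a, j)) = (\<Sum>b<q. x b * (\<Sum>a<d. W $$ (a, b) * g (a, j)))"
        unfolding sum_distrib_left sum_distrib_right by (subst sum.swap) (simp add: mult.assoc)
      also have "\<dots> = (\<Sum>b<q. x b * \<gamma> b j)" using \<gamma>_sum j kqp by (intro sum.cong) auto
      finally show ?thesis using j \<tau> d by (auto simp: field_simps)
    qed
    show "L2_set (\<lambda>b. \<gamma> b j) {..<d} \<le> sqrt (real d) * (8 * real d)" if j: "j < p" for j
    proof -
      have c: "col (mat d p g) j \<in> carrier_vec d" by (rule carrier_vecI) simp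
      have "L2_set (\<lambda>b. \<gamma> b j) {..<d} = vec_norm2 (col (mat d p g) j)"
        unfolding \<gamma>_def by (rule vec_norm2_eq_L2_set[OF W c, symmetric])
      also have "\<dots> = L2_set (\<lambda>a. \<bar>g (a, j)\<bar>) {..<d}"
        using j by (simp add: vec_norm2_def L2_set_def scalar_prod_def lessThan_atLeast0 power2_eq_square)
      also have "\<dots> \<le> L2_set (\<lambda>a. 8 * real d) {..<d}" by (intro L2_set_mono) (use g(1) j in auto)
      also have "\<dots> = sqrt (real d) * (8 * real d)" by (simp add: L2_set_def real_sqrt_mult)
      finally show ?thesis .
    qed
    show "0 \<le> \<tau> * (real d)\<^sup>2" using \<tau> by simp
    show "(\<Sum>l<d. (\<Sum>b<q. x b * W $$ (l, b))\<^sup>2) = (\<Sum>b<q. (x b)\<^sup>2)" for x :: "nat \<Rightarrow> real"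
    proof -
      define z where "z = vec d (\<lambda>b. if b < q then x b else 0)"
      have z: "z \<in> carrier_vec d" by (simp add: z_def)
      have ext: "(\<Sum>b<d. if b < q then f b else 0) = (\<Sum>b<q. f b)" for f :: "nat \<Rightarrow> real"
        using kqp by (intro sum.mono_neutral_cong_right) auto
      have "(W *\<^sub>v z) \<bullet> (W *\<^sub>v z) = (transpose_mat W *\<^sub>v (W *\<^sub>v z)) \<bullet> z"
        using W z by (intro scalar_prod_mult_mat_vec) auto
      also have "transpose_mat W *\<^sub>v (W *\<^sub>v z) = (transpose_mat W * W) *\<^sub>v z"
        using W z by (intro assoc_mult_mat_vec[symmetric]) auto
      also have "\<dots> = z" unfolding W(2) using z by simp
      finally have "(W *\<^sub>v z) \<bullet> (W *\<^sub>v z) = z \<bullet> z" .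
      moreover have "(W *\<^sub>v z) $ l = (\<Sum>b<q. x b * W $$ (l, b))" if "l < d" for l
      proof -
        have "(W *\<^sub>v z) $ l = (\<Sum>b<d. if b < q then x b * W $$ (l, b) else 0)"
          using that W by (auto simp: z_def scalar_prod_def lessThan_atLeast0 intro!: sum.cong)
        then show ?thesis unfolding ext .
      qed
      moreover have "z \<bullet> z = (\<Sum>b<d. if b < q then (x b)\<^sup>2 else 0)"
        by (auto simp: z_def scalar_prod_def lessThan_atLeast0 power2_eq_square intro!: sum.cong)
      ultimately show ?thesis
        using W by (simp add: scalar_prod_def[of "W *\<^sub>v z" "W *\<^sub>v z"] lessThan_atLeast0[symmetric] ext power2_eq_square)
    qed
  qed
  also have "sqrt (real d) * (\<tau> * (real d)\<^sup>2) * (sqrt (real d) * (8 * real d)) = 8 * \<tau> * (sqrt (real d) * sqrt (real d)) * (real d)\<^sup>2 * real d"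
    by (simp add: mult_ac)
  also have "\<dots> = 8 * \<tau> * real d ^ 4" by (simp add: power2_eq_square power4_eq_xxxx)
  \<comment> \<open>The fourth power is rounded up to the fifth, the form for which the number of
    iterations is calibrated.\<close>
  also have "\<dots> * (\<sigma> (q + 1) / \<sigma> k) ^ L \<le> 8 * \<tau> * real d ^ 5 * (\<sigma> (q + 1) / \<sigma> k) ^ L"
    using \<tau> d nonneg[of "q + 1"] nonneg[of k] kqp
    by (intro mult_right_mono mult_left_mono power_increasing) auto
  finally show "vec_norm2 ((1\<^sub>m d - X L * transpose_mat (X L)) * U *\<^sub>v v) \<le> 8 * \<tau> * real d ^ 5 * (\<sigma> (q + 1) / \<sigma> k) ^ L"
    using Mv vec_norm2_eq_L2_set[OF W r] by (simp add: M_def)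
qed

text \<open>The event is built from an eigenbasis of A, hence before any run is chosen; it therefore
  serves all choices of QR factors simultaneously.\<close>

lemma power_method_success_event:
  assumes \<tau>: "1 < \<tau>" and kqp: "1 \<le> k" "k \<le> q" "q \<le> p" "p \<le> d"
    and A: "\<forall>i<s. psd_mat d (A i)"
    and ev: "ordered_eigenvalues d (mat_sum d d s A) \<sigma>"
    and U: "top_eigenvectors d k (mat_sum d d s A) \<sigma> U"
    and gap: "\<sigma> (q + 1) < \<sigma> k" and \<epsilon>: "0 < \<epsilon>" "\<epsilon> < 1"
    and L: "(8 + ln \<tau> / ln 2) * (\<sigma> k / (\<sigma> k - \<sigma> (q + 1)) * ln (real d / \<epsilon>)) \<le> real L"
  shows "\<exists>E\<in>sets (gaussian_entries d p).
    measure (gaussian_entries d p) E \<ge> 1 - \<tau> powr (- real (p + 1 - q)) - exp (- real d) \<and>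
    (\<forall>g\<in>E. \<forall>X. distributed_power_run d p s A (mat d p g) L X \<longrightarrow>
      spectral_norm ((1\<^sub>m d - X L * transpose_mat (X L)) * U) \<le> \<epsilon>)"
proof -
  have A': "A i \<in> carrier_mat d d \<and> transpose_mat (A i) = A i" if "i < s" for i
    using A that by (simp add: psd_mat_def)
  have S: "mat_sum d d s A \<in> carrier_mat d d" by (simp add: mat_sum_def)
  obtain W where W: "W \<in> carrier_mat d d" "transpose_mat W * W = 1\<^sub>m d"
    "\<And>b. b < d \<Longrightarrow> mat_sum d d s A *\<^sub>v col W b = \<sigma> (b + 1) \<cdot>\<^sub>v col W b"
    using ordered_eigenbasis[OF S transpose_mat_sum[OF A'] ev] by metis
  have q: "1 \<le> q" using kqp by simp
  obtain E where E: "E \<in> sets (gaussian_entries d p)"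
    "measure (gaussian_entries d p) E \<ge> 1 - \<tau> powr (- real (p + 1 - q)) - exp (- real d)"
    "\<And>g i j. g \<in> E \<Longrightarrow> i < d \<Longrightarrow> j < p \<Longrightarrow> \<bar>g (i, j)\<bar> \<le> 8 * real d"
    "\<And>g l x. g \<in> E \<Longrightarrow> l < d \<Longrightarrow> \<exists>j<p. \<bar>\<Sum>b<q. x b * W $$ (l, b)\<bar> / (\<tau> * (real d)\<^sup>2)
      \<le> \<bar>\<Sum>a<d. (\<Sum>b<q. x b * W $$ (a, b)) * g (a, j)\<bar>"
    by (rule gaussian_entries_good_event[OF \<tau> q kqp(3,4), of "\<lambda>b l. W $$ (l, b)"]) (rule that)
  have nonneg: "0 \<le> \<sigma> (q + 1)"
    using ev kqp by (cases "q = d") (auto simp: ordered_eigenvalues_def)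
  have small: "8 * \<tau> * real d ^ 5 * (\<sigma> (q + 1) / \<sigma> k) ^ L \<le> \<epsilon>"
  \<comment> \<open>For d = 1 no power of d absorbs the prefactor \<open>8 * \<tau>\<close>. But
    then q = d, so the convention \<sigma>_{d+1} = 0 makes the ratio zero, and L is positive because
    ln (1 / \<epsilon>) is.\<close>
  proof (cases "d = 1")
    case True
    then have "q = d" using kqp by simp
    then have "\<sigma> (q + 1) = 0" using ev by (simp add: ordered_eigenvalues_def)
    moreover have "0 < (8 + ln \<tau> / ln 2) * (\<sigma> k / (\<sigma> k - \<sigma> (q + 1)) * ln (real d / \<epsilon>))"
      using \<tau> gap nonneg \<epsilon> True by (intro mult_pos_pos divide_pos_pos add_pos_pos) auto
    then have "0 < L" using L by linarith
    ultimately show ?thesis using \<epsilon> by (simp add: zero_power)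
  next
    case False
    then have "2 \<le> d" using kqp by simp
    then show ?thesis by (rule iteration_count_suffices[OF \<tau> _ nonneg gap \<epsilon> L])
  qed
  show ?thesis
  proof (intro bexI[OF _ E(1)] conjI E(2) ballI allI impI)
    fix g X assume g: "g \<in> E" and run: "distributed_power_run d p s A (mat d p g) L X"
    have "spectral_norm ((1\<^sub>m d - X L * transpose_mat (X L)) * U) \<le> 8 * \<tau> * real d ^ 5 * (\<sigma> (q + 1) / \<sigma> k) ^ L"
      by (rule power_run_residual_norm[OF kqp A' ev U gap W \<tau> E(3)[OF g] E(4)[OF g] run])
    then show "spectral_norm ((1\<^sub>m d - X L * transpose_mat (X L)) * U) \<le> \<epsilon>"
      using small by linarith
  qed
qed

theorem corollary3p2:
  shows "\<exists>c\<^sub>1>0. \<exists>c\<^sub>2>0. \<forall>\<tau>>1. \<exists>C>0.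
    \<forall>(C' :: real) (d :: nat) (s :: nat) (k :: nat) (q :: nat) (p :: nat)
      (A :: nat \<Rightarrow> real mat) (\<sigma> :: nat \<Rightarrow> real) (U :: real mat) (\<epsilon> :: real) (L :: nat).
      1 \<le> k \<and> k \<le> q \<and> q \<le> p \<and> p \<le> d \<and>
      (\<forall>i<s. psd_mat d (A i)) \<and>
      ordered_eigenvalues d (mat_sum d d s A) \<sigma> \<and>
      top_eigenvectors d k (mat_sum d d s A) \<sigma> U \<and>
      \<sigma> k > \<sigma> (q + 1) \<and>
      0 < \<epsilon> \<and> \<epsilon> < 1 \<and>
      C * (\<sigma> k / (\<sigma> k - \<sigma> (q + 1)) * ln (real d / \<epsilon>)) \<le> real L \<and>
      real L \<le> C' * (\<sigma> k / (\<sigma> k - \<sigma> (q + 1)) * ln (real d / \<epsilon>)) \<longrightarrow>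
      (\<exists>E\<in>sets (gaussian_entries d p).
         measure (gaussian_entries d p) E
           \<ge> 1 - \<tau> powr (- (c\<^sub>1 * real (p + 1 - q))) - exp (- (c\<^sub>2 * real d)) \<and>
         (\<forall>g\<in>E. \<forall>X. distributed_power_run d p s A (mat d p g) L X \<longrightarrow>
            spectral_norm ((1\<^sub>m d - X L * transpose_mat (X L)) * U) \<le> \<epsilon>))"
\<comment> \<open>Both exponents of the good event already have constant 1, and \<tau> enters only C
  = 8 + log_2 \<tau>: the prefactor 8 \<tau> d^5 contributes 3 for the 8 and 5 for the power of d,
  with log_2 \<tau> for \<tau>.\<close>
proof (rule exI[of _ 1], rule conjI, simp, rule exI[of _ 1], rule conjI, simp,
    intro allI impI, goal_cases)
  case (1 \<tau>)
  show ?case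
    unfolding mult_1_left
  proof (rule exI[of _ "8 + ln \<tau> / ln 2"], rule conjI)
    show "0 < 8 + ln \<tau> / ln 2" using 1 by (intro add_pos_pos divide_pos_pos) auto
  qed (intro allI impI, elim conjE, rule power_method_success_event[OF 1]; assumption)
qed

end
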